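(* Let $\mathcal H=\mathcal H_0\oplus\mathcal H_1$, $A$, $W$, $V$, $X$, $Y$, $T$ be as in the context. Suppose, furthermore, that $V$ is $A$-bounded with $A$-bound $0$. Then the graph subspace $\mathcal G(\mathcal H_0,X)$ is reducing for the operator $A+V$ if and only if $Y$ is a strong solution to the operator Riccati equation $AY-YA-YVY+V=0$. In this case, $A+V$ is a self-adjoint operator that admits the two block diagonalizations (as equalities of operators, including domains) $$T^{-1}(A+V)T=A+VY=\begin{pmatrix}A_0+WX&0\\0&A_1-W^*X^*\end{pmatrix}$$ and $$T^*(A+V)(T^* )^{-1}=A-YV=\begin{pmatrix}A_0+X^*W^*&0\\0&A_1-XW\end{pmatrix}.$$ In particular, the operators $A+VY$ and $A-YV$ are both closed and similar to the self-adjoint operator $A+V$. Moreover, with $U$ the unitary operator from the polar decomposition $T=U|T|$, $|T|=(T^*T)^{1/2}$, the following unitary block diagonalization holds: $$U^*(A+V)U=|T|(A+VY)|T|^{-1}=|T|^{-1}(A-YV)|T|=\begin{pmatrix}B_0&0\\0&B_1\end{pmatrix},$$ where $$B_0=(I+X^*X)^{1/2}(A_0+WX)(I+X^*X)^{-1/2},\qquad \mathrm{Dom}(B_0)=(I+X^*X)^{1/2}\,\mathrm{Dom}(A_0),$$ $$B_1=(I+XX^* )^{1/2}(A_1-W^*X^* )(I+XX^* )^{-1/2},\qquad \mathrm{Dom}(B_1)=(I+XX^* )^{1/2}\,\mathrm{Dom}(A_1).$$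
   Context: Hilbert spaces are complex. Setting: $\mathcal H=\mathcal H_0\oplus\mathcal H_1$ is a Hilbert space decomposed into two orthogonal subspaces. $A=\begin{pmatrix}A_0&0\\0&A_1\end{pmatrix}$ with $\mathrm{Dom}(A)=\mathrm{Dom}(A_0)\oplus\mathrm{Dom}(A_1)$ is a (possibly unbounded) self-adjoint operator on $\mathcal H$. $W\colon\mathcal H_1\supset\mathrm{Dom}(W)\to\mathcal H_0$ is a densely defined linear operator with $\mathrm{Dom}(W)\supset\mathrm{Dom}(A_1)$ and $\mathrm{Dom}(W^* )\supset\mathrm{Dom}(A_0)$, and $V=\begin{pmatrix}0&W\\ W^*&0\end{pmatrix}$ on $\mathrm{Dom}(V)=\mathrm{Dom}(W^* )\oplus\mathrm{Dom}(W)\supset\mathrm{Dom}(A)$. $X\colon\mathcal H_0\to\mathcal H_1$ is a bounded linear operator, and $$Y=\begin{pmatrix}0&-X^*\\ X&0\end{pmatrix},\qquad T=I_{\mathcal H}+Y=\begin{pmatrix}I_{\mathcal H_0}&-X^*\\ X&I_{\mathcal H_1}\end{pmatrix}$$ are bounded operators on $\mathcal H$. Since $Y^*=-Y$, one has $T^*=I_{\mathcal H}-Y$, and $T$, $T^*$ are boundedly invertible. Conventions on unbounded operators: sums and products have their natural domains, $\mathrm{Dom}(K+L)=\mathrm{Dom}(K)\cap\mathrm{Dom}(L)$ and $\mathrm{Dom}(KL)=\{x\in\mathrm{Dom}(L):Lx\in\mathrm{Dom}(K)\}$. In particular $\mathrm{Dom}(A+V)=\mathrm{Dom}(A)=\mathrm{Dom}(A-YV)$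 and $\mathrm{Dom}(A+VY)=\{x\in\mathrm{Dom}(A):Yx\in\mathrm{Dom}(V)\}$; the entries of block diagonal matrices likewise have natural domains unless stated. $K=L$ means equal domains and equal action. A linear operator $H$ on $\mathcal H$ with $\mathrm{Dom}(H)\supset\mathrm{Dom}(A)$ is $A$-bounded if there are $a,b\ge0$ with $\|Hx\|\le a\|x\|+b\|Ax\|$ for all $x\in\mathrm{Dom}(A)$; its $A$-bound is the infimum of all possible choices of $b$. Graph subspaces: $\mathcal G(\mathcal H_0,X)=\{f\oplus Xf:f\in\mathcal H_0\}$, a closed subspace with orthogonal complement $\mathcal G(\mathcal H_1,-X^* )=\{-X^*g\oplus g:g\in\mathcal H_1\}$. A closed subspace $\mathcal G\subset\mathcal H$ is invariant for a linear operator $B$ if $Bx\in\mathcal G$ for all $x\in\mathrm{Dom}(B)\cap\mathcal G$. It is reducing for $B$ if $\mathcal G$ and $\mathcal G^\perp$ are both invariant for $B$ and $\mathrm{Dom}(B)=(\mathrm{Dom}(B)\cap\mathcal G)+(\mathrm{Dom}(B)\cap\mathcal G^\perp)$. $Y$ is a strong solution to the operator Riccati equation $AY-YA-YVY+V=0$ if $Yx\in\mathrm{Dom}(A)$ and $AYx-YAx-YVYx+Vx=0$ for all $x\in\mathrm{Dom}(A)$. *)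

theory Defs
  imports "HOL-Analysis.Analysis"
begin

section \<open>Complex Hilbert spaces\<close>

text \<open>The complex structure extends the real one of the library: \<open>inner\<close> is the real part of
  \<open>cinner\<close>, so norm, topology and completeness are those of \<open>real_inner\<close> and
  \<open>complete_space\<close>. The complex inner product is linear in its second argument.\<close>

class complex_hilbert_space = real_inner + complete_space +
  fixes scaleC :: "complex \<Rightarrow> 'a \<Rightarrow> 'a"  (infixr "*\<^sub>C" 75)
    and cinner :: "'a \<Rightarrow> 'a \<Rightarrow> complex"
  assumes scaleC_add_right: "a *\<^sub>C (x + y) = a *\<^sub>C x + a *\<^sub>C y"
    and scaleC_add_left: "(a + b) *\<^sub>C x = a *\<^sub>C x + b *\<^sub>C x"
    and scaleC_scaleC: "a *\<^sub>C b *\<^sub>C x = (a * b) *\<^sub>C x"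
    and scaleR_scaleC: "r *\<^sub>R x = complex_of_real r *\<^sub>C x"
    and cinner_commute: "cinner x y = cnj (cinner y x)"
    and cinner_add_right: "cinner x (y + z) = cinner x y + cinner x z"
    and cinner_scaleC_right: "cinner x (a *\<^sub>C y) = a * cinner x y"
    and inner_Re_cinner: "inner x y = Re (cinner x y)"

instantiation complex :: complex_hilbert_space
begin

definition scaleC_complex :: "complex \<Rightarrow> complex \<Rightarrow> complex"
  where "scaleC_complex a x = a * x"

definition cinner_complex :: "complex \<Rightarrow> complex \<Rightarrow> complex"
  where "cinner_complex x y = cnj x * y"

instance
  by standard
    (simp_all add: scaleC_complex_def cinner_complex_def inner_complex_def algebra_simps
      scaleR_conv_of_real)

end

text \<open>The orthogonal sum of two Hilbert spaces is the product type; its norm is the library's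
  Euclidean product norm.\<close>

instantiation prod :: (complex_hilbert_space, complex_hilbert_space) complex_hilbert_space
begin

definition scaleC_prod :: "complex \<Rightarrow> 'a \<times> 'b \<Rightarrow> 'a \<times> 'b"
  where "scaleC_prod a x = (a *\<^sub>C fst x, a *\<^sub>C snd x)"

definition cinner_prod :: "'a \<times> 'b \<Rightarrow> 'a \<times> 'b \<Rightarrow> complex"
  where "cinner_prod x y = cinner (fst x) (fst y) + cinner (snd x) (snd y)"

instance
proof
  fix x y :: "'a \<times> 'b"
  show "cinner x y = cnj (cinner y x)"
    by (simp add: cinner_prod_def cinner_commute[of "fst x" "fst y"]
        cinner_commute[of "snd x" "snd y"])
qed (simp_all add: scaleC_prod_def cinner_prod_def inner_prod_def scaleC_add_right
    scaleC_add_left scaleC_scaleC scaleR_scaleC cinner_add_right cinner_scaleC_right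
    inner_Re_cinner algebra_simps prod_eq_iff)

end

definition csubspace :: "'a::complex_hilbert_space set \<Rightarrow> bool"
  where "csubspace S \<longleftrightarrow>
    0 \<in> S \<and> (\<forall>x\<in>S. \<forall>y\<in>S. x + y \<in> S) \<and> (\<forall>c. \<forall>x\<in>S. c *\<^sub>C x \<in> S)"

definition orth_compl :: "'a::complex_hilbert_space set \<Rightarrow> 'a set"
  where "orth_compl S = {x. \<forall>y\<in>S. cinner y x = 0}"

section \<open>Unbounded operators\<close>

text \<open>An operator is a partial map \<open>K\<close> with domain \<open>dom K\<close>, so that \<open>K = L\<close> means equal domains
  and equal action. The identity is \<open>Some\<close>, the product of operators on its natural domain is
  \<open>\<circ>\<^sub>m\<close>, and the graph is \<open>Map.graph\<close>.\<close>

type_synonym ('a, 'b) operator = "'a \<Rightarrow> 'b option"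

definition linear_op ::
    "('a::complex_hilbert_space, 'b::complex_hilbert_space) operator \<Rightarrow> bool"
  where "linear_op K \<longleftrightarrow> csubspace (dom K)
    \<and> (\<forall>x\<in>dom K. \<forall>y\<in>dom K. the (K (x + y)) = the (K x) + the (K y))
    \<and> (\<forall>c. \<forall>x\<in>dom K. the (K (c *\<^sub>C x)) = c *\<^sub>C the (K x))"

definition densely_defined :: "('a::complex_hilbert_space, 'b) operator \<Rightarrow> bool"
  where "densely_defined K \<longleftrightarrow> closure (dom K) = UNIV"

definition closed_op ::
    "('a::complex_hilbert_space, 'b::complex_hilbert_space) operator \<Rightarrow> bool"
  where "closed_op K \<longleftrightarrow> linear_op K \<and> closed (Map.graph K)"

definition bounded_op ::
    "('a::complex_hilbert_space, 'b::complex_hilbert_space) operator \<Rightarrow> bool"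
  where "bounded_op K \<longleftrightarrow>
    linear_op K \<and> dom K = UNIV \<and> (\<exists>c. \<forall>x. norm (the (K x)) \<le> c * norm x)"

definition op_zero :: "('a, 'b::complex_hilbert_space) operator"
  where "op_zero = (\<lambda>x. Some 0)"

text \<open>Sums bind weaker than the product \<open>\<circ>\<^sub>m\<close> and have the intersection of the domains.\<close>

definition op_plus ::
    "('a, 'b::complex_hilbert_space) operator \<Rightarrow> ('a, 'b) operator \<Rightarrow> ('a, 'b) operator"
    (infixl "+\<^sub>o" 52)
  where "K +\<^sub>o L = (\<lambda>x. Some (the (K x) + the (L x))) |` (dom K \<inter> dom L)"

definition op_minus ::
    "('a, 'b::complex_hilbert_space) operator \<Rightarrow> ('a, 'b) operator \<Rightarrow> ('a, 'b) operator"
    (infixl "-\<^sub>o" 52)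
  where "K -\<^sub>o L = (\<lambda>x. Some (the (K x) - the (L x))) |` (dom K \<inter> dom L)"

definition op_uminus :: "('a, 'b::complex_hilbert_space) operator \<Rightarrow> ('a, 'b) operator"
    ("-\<^sub>o _" [81] 80)
  where "-\<^sub>o K = map_option uminus \<circ> K"

text \<open>The inverse is defined exactly at the vectors with a unique preimage; for injective \<open>K\<close> its
  domain is the range of \<open>K\<close>.\<close>

definition op_inv :: "('a, 'b) operator \<Rightarrow> ('b, 'a) operator"
  where "op_inv K = (\<lambda>y. Some (THE x. K x = Some y)) |` {y. \<exists>!x. K x = Some y}"

text \<open>\<open>z = K* y\<close> iff \<open>\<langle>K x, y\<rangle> = \<langle>x, z\<rangle>\<close> for all \<open>x \<in> dom K\<close>. Uniqueness of \<open>z\<close> is automatic when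
  \<open>K\<close> is densely defined, the only case in which the adjoint is meaningful.\<close>

definition adj ::
    "('a::complex_hilbert_space, 'b::complex_hilbert_space) operator \<Rightarrow> ('b, 'a) operator"
    ("_\<^sup>\<star>" [1000] 999)
  where "K\<^sup>\<star> = (\<lambda>y. Some (THE z. \<forall>x\<in>dom K. cinner (the (K x)) y = cinner x z))
    |` {y. \<exists>!z. \<forall>x\<in>dom K. cinner (the (K x)) y = cinner x z}"

definition self_adjoint :: "('a::complex_hilbert_space, 'a) operator \<Rightarrow> bool"
  where "self_adjoint K \<longleftrightarrow> linear_op K \<and> densely_defined K \<and> K\<^sup>\<star> = K"

definition unitary_op ::
    "('a::complex_hilbert_space, 'b::complex_hilbert_space) operator \<Rightarrow> bool"
  where "unitary_op U \<longleftrightarrow> bounded_op U \<and> U\<^sup>\<star> \<circ>\<^sub>m U = Some \<and> U \<circ>\<^sub>m U\<^sup>\<star> = Some"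

definition boundedly_invertible ::
    "('a::complex_hilbert_space, 'b::complex_hilbert_space) operator \<Rightarrow> bool"
  where "boundedly_invertible S \<longleftrightarrow> bounded_op S \<and> bounded_op (op_inv S)"

definition similar_op ::
    "('a::complex_hilbert_space, 'a) operator
      \<Rightarrow> ('b::complex_hilbert_space, 'b) operator \<Rightarrow> bool"
  where "similar_op K L \<longleftrightarrow> (\<exists>S. boundedly_invertible S \<and> K = op_inv S \<circ>\<^sub>m L \<circ>\<^sub>m S)"

definition positive_op :: "('a::complex_hilbert_space, 'a) operator \<Rightarrow> bool"
  where "positive_op P \<longleftrightarrow>
    bounded_op P \<and> P\<^sup>\<star> = P \<and> (\<forall>x. cinner x (the (P x)) \<in> \<real>\<^sub>\<ge>\<^sub>0)"

text \<open>The unique positive square root of a bounded positive operator.\<close>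

definition op_sqrt ::
    "('a::complex_hilbert_space, 'a) operator \<Rightarrow> ('a, 'a) operator"
  where "op_sqrt P = (THE S. positive_op S \<and> S \<circ>\<^sub>m S = P)"

definition op_abs ::
    "('a::complex_hilbert_space, 'b::complex_hilbert_space) operator \<Rightarrow> ('a, 'a) operator"
  where "op_abs K = op_sqrt (K\<^sup>\<star> \<circ>\<^sub>m K)"

definition block ::
    "('a, 'c) operator \<Rightarrow> ('b, 'c) operator \<Rightarrow> ('a, 'd) operator \<Rightarrow> ('b, 'd) operator
      \<Rightarrow> ('a \<times> 'b, 'c::complex_hilbert_space \<times> 'd::complex_hilbert_space) operator"
  where "block K\<^sub>0\<^sub>0 K\<^sub>0\<^sub>1 K\<^sub>1\<^sub>0 K\<^sub>1\<^sub>1 =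
    (\<lambda>(f, g). Some (the (K\<^sub>0\<^sub>0 f) + the (K\<^sub>0\<^sub>1 g), the (K\<^sub>1\<^sub>0 f) + the (K\<^sub>1\<^sub>1 g)))
      |` ((dom K\<^sub>0\<^sub>0 \<inter> dom K\<^sub>1\<^sub>0) \<times> (dom K\<^sub>0\<^sub>1 \<inter> dom K\<^sub>1\<^sub>1))"

abbreviation block_diag ::
    "('a, 'c) operator \<Rightarrow> ('b, 'd) operator
      \<Rightarrow> ('a \<times> 'b, 'c::complex_hilbert_space \<times> 'd::complex_hilbert_space) operator"
  where "block_diag K\<^sub>0 K\<^sub>1 \<equiv> block K\<^sub>0 op_zero op_zero K\<^sub>1"

section \<open>Relative boundedness, invariance, Riccati equation\<close>

definition admissible_bounds ::
    "('a::complex_hilbert_space, 'a) operator \<Rightarrow> ('a, 'a) operator \<Rightarrow> real \<Rightarrow> real \<Rightarrow> bool"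
  where "admissible_bounds H A a b \<longleftrightarrow> a \<ge> 0 \<and> b \<ge> 0
    \<and> (\<forall>x\<in>dom A. norm (the (H x)) \<le> a * norm x + b * norm (the (A x)))"

definition relatively_bounded ::
    "('a::complex_hilbert_space, 'a) operator \<Rightarrow> ('a, 'a) operator \<Rightarrow> bool"
  where "relatively_bounded H A \<longleftrightarrow>
    linear_op H \<and> dom A \<subseteq> dom H \<and> (\<exists>a b. admissible_bounds H A a b)"

definition relative_bound ::
    "('a::complex_hilbert_space, 'a) operator \<Rightarrow> ('a, 'a) operator \<Rightarrow> real"
  where "relative_bound H A = Inf {b. \<exists>a. admissible_bounds H A a b}"

definition invariant_for ::
    "'a::complex_hilbert_space set \<Rightarrow> ('a, 'a) operator \<Rightarrow> bool"
  where "invariant_for G B \<longleftrightarrow>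
    csubspace G \<and> closed G \<and> (\<forall>x\<in>dom B \<inter> G. the (B x) \<in> G)"

definition reducing_for ::
    "'a::complex_hilbert_space set \<Rightarrow> ('a, 'a) operator \<Rightarrow> bool"
  where "reducing_for G B \<longleftrightarrow> invariant_for G B \<and> invariant_for (orth_compl G) B
    \<and> dom B = {x + y | x y. x \<in> dom B \<inter> G \<and> y \<in> dom B \<inter> orth_compl G}"

text \<open>Stated pointwise on \<open>dom A\<close>. All values exist there when \<open>Y\<close> is everywhere defined and
  \<open>dom A \<subseteq> dom V\<close>.\<close>

definition strong_riccati_solution ::
    "('a::complex_hilbert_space, 'a) operator \<Rightarrow> ('a, 'a) operator \<Rightarrow> ('a, 'a) operator
      \<Rightarrow> bool"
  where "strong_riccati_solution A V Y \<longleftrightarrow> (\<forall>x\<in>dom A.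
    the (Y x) \<in> dom A
    \<and> the ((A \<circ>\<^sub>m Y) x) - the ((Y \<circ>\<^sub>m A) x) - the ((Y \<circ>\<^sub>m V \<circ>\<^sub>m Y) x) + the (V x) = 0)"

end

theory Submission
  imports Defs
begin

text \<open>Since \<open>V\<close> has \<open>A\<close>-bound \<open>0\<close>, both \<open>V\<close> and \<open>Y V\<close> are small perturbations of \<open>A\<close>: \<open>A + V\<close> is
  self-adjoint and \<open>A - Y V - i r\<close> maps \<open>Dom(A)\<close> bijectively onto the space for large real \<open>r\<close>.
  The Riccati equation says that \<open>T\<^sup>* (A + V) = (A - Y V) T\<^sup>*\<close> and \<open>(A + V) T = T (A + V Y)\<close> on
  \<open>Dom(A)\<close>, and comparing the ranges of the shifted operators in such an intertwining relation
  forces \<open>T\<^sup>* Dom(A) = Dom(A)\<close>. Conjugation with \<open>diag(1, -1)\<close> exchanges \<open>T\<close> and \<open>T\<^sup>*\<close>, hence also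
  \<open>T Dom(A) = Dom(A)\<close>, which gives the block diagonalizations with equality of domains. As
  \<open>T\<^sup>* T = 1 - Y\<^sup>2\<close> is block diagonal and at least \<open>1\<close>, so is its square root \<open>|T|\<close>, and \<open>U = T |T|\<^sup>-\<^sup>1\<close>.\<close>

text \<open>The difficulty lies in the domains. \<open>A - Y V\<close> has domain
  \<open>Dom(A)\<close> from the start, and bound 0 makes \<open>Y V\<close> as small as desired
  relative to \<open>A\<close> whatever the norm of \<open>Y\<close>; a positive bound would be
  multiplied by that norm. No such control of \<open>V Y\<close> is at hand, as \<open>Y\<close>
  need not map \<open>Dom(A)\<close> into \<open>Dom(V)\<close>. Hence every comparison of domains
  runs through \<open>A - Y V\<close>, and \<open>diag(1, -1)\<close> stands in for the
  corresponding argument for \<open>A + V Y\<close>. In general \<open>A - Y V\<close> is not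
  symmetric, so bijectivity of its shifts comes from a fixed point instead of self-adjointness; the
  shifts are imaginary because those are invertible for every self-adjoint operator. That the graph
  subspace is reducing directly yields only that the preimage of \<open>Dom(A)\<close> under
  \<open>T\<close> lies in \<open>Dom(A)\<close>; the opposite inclusion appears after passing to
  adjoints. Computations use total functions paired with a domain set and the real inner product;
  complex linearity brings back the complex adjoint.\<close>

instance complex_hilbert_space \<subseteq> banach ..

section \<open>Geometry of complex Hilbert spaces\<close>

text \<open>The imaginary part is again a real part, after multiplying the first argument by \<i>.
  Complex-linear statements can therefore be proved with \<open>inner\<close> alone.\<close>

lemma cinner_inner: "cinner x y = Complex (inner x y) (inner (\<i> *\<^sub>C x) y)"
proof -
  have "cinner (\<i> *\<^sub>C x) y = - \<i> * cinner x y"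
    by (metis cinner_commute cinner_scaleC_right complex_cnj_i complex_cnj_mult)
  then show ?thesis
    by (simp add: inner_Re_cinner complex_eq_iff)
qed

lemma scaleC_minus_right: "c *\<^sub>C (- x) = - (c *\<^sub>C (x::'a::complex_hilbert_space))"
  by (metis add.right_inverse add_cancel_right_left add_eq_0_iff scaleC_add_right)

lemma scaleC_diff_right: "c *\<^sub>C (x - y) = c *\<^sub>C x - c *\<^sub>C (y::'a::complex_hilbert_space)"
  by (metis add_uminus_conv_diff scaleC_add_right scaleC_minus_right)

lemma scaleC_zero_right [simp]: "c *\<^sub>C (0::'a::complex_hilbert_space) = 0"
  by (metis cancel_comm_monoid_add_class.diff_cancel scaleC_diff_right)

lemma scaleC_minus_one: "(- 1) *\<^sub>C (x::'a::complex_hilbert_space) = - x"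
  by (metis of_real_1 of_real_minus scaleR_minus1_left scaleR_scaleC)

lemma inner_i_right: "inner x (\<i> *\<^sub>C y) = - inner (\<i> *\<^sub>C x) y"
proof -
  have "inner x (\<i> *\<^sub>C y) = - Im (cinner x y)"
    by (simp add: inner_Re_cinner cinner_scaleC_right)
  then show ?thesis by (simp add: cinner_inner)
qed

lemma scaleC_i_i: "\<i> *\<^sub>C \<i> *\<^sub>C (x::'a::complex_hilbert_space) = - x"
  by (simp add: scaleC_scaleC scaleC_minus_one)

lemma inner_i_i: "inner (\<i> *\<^sub>C x) (\<i> *\<^sub>C y) = inner x y"
  by (simp add: inner_i_right scaleC_i_i)

lemma norm_scaleC_i: "norm (\<i> *\<^sub>C (x::'a::complex_hilbert_space)) = norm x"
  by (simp add: norm_eq_sqrt_inner inner_i_i)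

lemma scaleC_Complex: "c *\<^sub>C (x::'a::complex_hilbert_space) = Re c *\<^sub>R x + Im c *\<^sub>R (\<i> *\<^sub>C x)"
proof -
  have "c = complex_of_real (Re c) + complex_of_real (Im c) * \<i>"
    by (simp add: complex_eq mult.commute)
  then show ?thesis
    by (metis scaleC_add_left scaleC_scaleC scaleR_scaleC)
qed

lemma csubspace_iff: "csubspace S \<longleftrightarrow> subspace S \<and> (\<forall>x\<in>S. \<i> *\<^sub>C x \<in> S)"
proof
  assume S: "csubspace S"
  then show "subspace S \<and> (\<forall>x\<in>S. \<i> *\<^sub>C x \<in> S)"
    unfolding csubspace_def subspace_def by (metis scaleR_scaleC)
next
  assume "subspace S \<and> (\<forall>x\<in>S. \<i> *\<^sub>C x \<in> S)"
  then have S: "subspace S" "\<And>x. x \<in> S \<Longrightarrow> \<i> *\<^sub>C x \<in> S" by auto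
  have "c *\<^sub>C x \<in> S" if "x \<in> S" for c x
    unfolding scaleC_Complex[of c] by (intro subspace_add subspace_scale S that)
  with S(1) show "csubspace S"
    unfolding csubspace_def by (auto intro: subspace_add subspace_0)
qed

text \<open>Distance-minimizing sequences are Cauchy by the parallelogram law; a minimizer \<open>y\<close> of the
  distance to \<open>x\<close> satisfies \<open>x - y \<perp> S\<close>.\<close>

lemma closed_subspace_eq_UNIV:
  fixes S :: "'a::complex_hilbert_space set"
  assumes S: "subspace S" and cl: "closed S"
    and orth: "\<And>z. (\<And>y. y \<in> S \<Longrightarrow> inner y z = 0) \<Longrightarrow> z = 0"
  shows "S = UNIV"
proof -
  have "x \<in> S" for x
  proof -
    define d where "d = infdist x S"
    have S0: "S \<noteq> {}" using subspace_0[OF S] by auto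
    have d0: "0 \<le> d" by (simp add: d_def infdist_nonneg)
    have dle: "d \<le> norm (x - y)" if "y \<in> S" for y
      using infdist_le[OF that, of x] by (simp add: d_def dist_norm)
    have "\<exists>y\<in>S. dist x y < d + inverse (real (Suc n))" for n
      using cInf_lessD[of "dist x ` S" "d + inverse (real (Suc n))"] S0
      by (auto simp: d_def infdist_def)
    then obtain y where yS: "\<And>n. y n \<in> S"
      and yd: "\<And>n. dist x (y n) < d + inverse (real (Suc n))" by metis
    have lim: "(\<lambda>n. norm (x - y n)) \<longlonglongrightarrow> d"
    proof (rule tendsto_sandwich[where f = "\<lambda>_. d" and h = "\<lambda>n. d + inverse (real (Suc n))"])
      show "(\<lambda>n. d + inverse (real (Suc n))) \<longlonglongrightarrow> d"
        using tendsto_add[OF tendsto_const LIMSEQ_inverse_real_of_nat, of d] by simp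
    qed (use dle yS yd in \<open>auto simp: dist_norm less_imp_le simp del: of_nat_Suc\<close>)
    have par: "(norm (y m - y n))\<^sup>2 \<le> 2 * (norm (x - y m))\<^sup>2 + 2 * (norm (x - y n))\<^sup>2 - 4 * d\<^sup>2" for m n
    proof -
      define w where "w = (1/2) *\<^sub>R (y m + y n)"
      have "w \<in> S" by (simp add: w_def S subspace_add subspace_scale yS)
      then have "d\<^sup>2 \<le> (norm (x - w))\<^sup>2" using dle d0 by (simp add: power_mono)
      moreover have "(norm (y m - y n))\<^sup>2
          = 2 * (norm (x - y m))\<^sup>2 + 2 * (norm (x - y n))\<^sup>2 - 4 * (norm (x - w))\<^sup>2"
        unfolding power2_norm_eq_inner w_def
        by (simp add: inner_diff inner_add inner_commute algebra_simps)
      ultimately show ?thesis by simp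
    qed
    have "Cauchy y"
    proof (rule CauchyI)
      fix e :: real assume e: "e > 0"
      have "(\<lambda>n. (norm (x - y n))\<^sup>2) \<longlonglongrightarrow> d\<^sup>2"
        by (intro tendsto_intros lim)
      moreover have "d\<^sup>2 < d\<^sup>2 + e\<^sup>2 / 4" using e by simp
      ultimately have "eventually (\<lambda>n. (norm (x - y n))\<^sup>2 < d\<^sup>2 + e\<^sup>2 / 4) sequentially"
        by (rule order_tendstoD)
      then obtain M where M: "\<And>n. n \<ge> M \<Longrightarrow> (norm (x - y n))\<^sup>2 < d\<^sup>2 + e\<^sup>2 / 4"
        unfolding eventually_sequentially by auto
      have "norm (y m - y n) < e" if "m \<ge> M" "n \<ge> M" for m n
      proof -
        have "(norm (y m - y n))\<^sup>2 < e\<^sup>2"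
          using par[of m n] M[OF that(1)] M[OF that(2)] by linarith
        then show ?thesis using e power2_less_imp_less by (metis less_imp_le)
      qed
      then show "\<exists>M. \<forall>m\<ge>M. \<forall>n\<ge>M. norm (y m - y n) < e" by blast
    qed
    then obtain p where p: "y \<longlonglongrightarrow> p"
      using Cauchy_convergent convergent_def by blast
    have pS: "p \<in> S" using closed_sequentially[OF cl yS p] .
    have "(\<lambda>n. norm (x - y n)) \<longlonglongrightarrow> norm (x - p)" by (intro tendsto_intros p)
    then have pd: "norm (x - p) = d" using lim LIMSEQ_unique by blast
    have "inner v (x - p) = 0" if v: "v \<in> S" for v
    proof -
      define c where "c = inner v (x - p)"
      have "0 \<le> t\<^sup>2 * inner v v - 2 * t * c" for t
      proof -
        have "p + t *\<^sub>R v \<in> S" using pS v S by (simp add: subspace_add subspace_scale)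
        then have "(norm (x - p))\<^sup>2 \<le> (norm (x - (p + t *\<^sub>R v)))\<^sup>2"
          using dle pd d0 by (simp add: power_mono)
        then show ?thesis
          unfolding power2_norm_eq_inner c_def
          by (simp add: inner_diff inner_add inner_commute algebra_simps power2_eq_square)
      qed
      note h = this
      show ?thesis
      proof (cases "v = 0")
        case False
        then have vv: "inner v v > 0" by simp
        \<comment> \<open>The value \<open>t = c / inner v v\<close> minimizes the quadratic in
          \<open>h\<close>.\<close>
        have "0 \<le> (c / inner v v)\<^sup>2 * inner v v - 2 * (c / inner v v) * c" by (rule h)
        also have "\<dots> = - (c\<^sup>2 / inner v v)" using vv by (simp add: field_simps power2_eq_square)
        finally have "c\<^sup>2 \<le> 0" using vv by (simp add: field_simps)
        then show ?thesis by (simp add: c_def)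
      qed simp
    qed
    then have "x - p = 0" by (rule orth)
    then show ?thesis using pS by simp
  qed
  then show ?thesis by auto
qed

text \<open>The kernel of a nonzero functional is a proper closed subspace, so some nonzero
  \<open>z\<close> is orthogonal to it, and subtracting a multiple of \<open>z\<close> moves any
  vector into the kernel. The real version suffices because adjoints are taken with respect to
  \<open>inner\<close>.\<close>

lemma riesz_representation:
  fixes f :: "'a::complex_hilbert_space \<Rightarrow> real"
  assumes f: "bounded_linear f"
  obtains z where "\<And>x. f x = inner x z"
proof (cases "{x. f x = 0} = UNIV")
  case True
  then show ?thesis using that[of 0] by auto
next
  case False
  interpret bounded_linear f by (rule f)
  have "subspace {x. f x = 0}" by (auto simp: subspace_def add scaleR zero)
  moreover have "closed {x. f x = 0}"
    by (intro closed_Collect_eq continuous_intros continuous_on)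
  ultimately obtain z where z: "\<And>y. f y = 0 \<Longrightarrow> inner y z = 0" "z \<noteq> 0"
    using closed_subspace_eq_UNIV[of "{x. f x = 0}"] False by auto
  have fz: "f z \<noteq> 0" using z by force
  show ?thesis
  proof (rule that[of "(f z / inner z z) *\<^sub>R z"])
    fix x
    have "inner (x - (f x / f z) *\<^sub>R z) z = 0"
      using z(1) fz by (simp add: diff scaleR)
    then have "inner x z = f x / f z * inner z z" by (simp add: inner_diff_left)
    then show "f x = inner x ((f z / inner z z) *\<^sub>R z)" using z fz by simp
  qed
qed

section \<open>Bounded operators\<close>

definition bounded_clinear :: "('a::complex_hilbert_space \<Rightarrow> 'b::complex_hilbert_space) \<Rightarrow> bool"
  where "bounded_clinear f \<longleftrightarrow> bounded_linear f \<and> (\<forall>c x. f (c *\<^sub>C x) = c *\<^sub>C f x)"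

text \<open>Stated with the real inner product, so that real arguments apply; for complex-linear
  \<open>f\<close> it is the complex adjoint relation, by
  \<open>adjoint_pair_cinner\<close>.\<close>

definition adjoint_pair ::
    "('a::complex_hilbert_space \<Rightarrow> 'b::complex_hilbert_space) \<Rightarrow> ('b \<Rightarrow> 'a) \<Rightarrow> bool"
  where "adjoint_pair f g \<longleftrightarrow> (\<forall>x y. inner (f x) y = inner x (g y))"

lemma bounded_clinearI:
  assumes "\<And>x y. f (x + y) = f x + f y" "\<And>c x. f (c *\<^sub>C x) = c *\<^sub>C f x"
    "\<And>x. norm (f x) \<le> K * norm x"
  shows "bounded_clinear f"
  unfolding bounded_clinear_def
proof (intro conjI allI)
  show "bounded_linear f"
    by (rule bounded_linear_intro[where K = K])
      (use assms in \<open>auto simp: scaleR_scaleC mult.commute\<close>)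
qed (use assms in auto)

lemma bounded_clinear_scaleC: "bounded_clinear (\<lambda>x. c *\<^sub>C x)"
proof (rule bounded_clinearI[where K = "\<bar>Re c\<bar> + \<bar>Im c\<bar>"])
  fix x :: 'a
  have "norm (c *\<^sub>C x) \<le> norm (Re c *\<^sub>R x) + norm (Im c *\<^sub>R (\<i> *\<^sub>C x))"
    unfolding scaleC_Complex[of c] by (rule norm_triangle_ineq)
  then show "norm (c *\<^sub>C x) \<le> (\<bar>Re c\<bar> + \<bar>Im c\<bar>) * norm x"
    by (simp add: norm_scaleC_i algebra_simps)
qed (simp_all add: scaleC_add_right scaleC_scaleC mult.commute)

lemma bounded_clinear_compose:
  "bounded_clinear f \<Longrightarrow> bounded_clinear g \<Longrightarrow> bounded_clinear (\<lambda>x. f (g x))"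
  by (auto simp: bounded_clinear_def intro: bounded_linear_compose)

lemma bounded_clinear_ident: "bounded_clinear (\<lambda>x. x)"
  by (auto simp: bounded_clinear_def)

lemma bounded_clinear_add:
  "bounded_clinear f \<Longrightarrow> bounded_clinear g \<Longrightarrow> bounded_clinear (\<lambda>x. f x + g x)"
  by (auto simp: bounded_clinear_def scaleC_add_right intro: bounded_linear_add)

lemma bounded_clinear_diff:
  "bounded_clinear f \<Longrightarrow> bounded_clinear g \<Longrightarrow> bounded_clinear (\<lambda>x. f x - g x)"
  by (auto simp: bounded_clinear_def scaleC_diff_right intro: bounded_linear_sub)

lemma bounded_clinearD:
  assumes "bounded_clinear f"
  shows "f (x + y) = f x + f y" "f (x - y) = f x - f y" "f (- x) = - f x" "f 0 = 0"
    "f (c *\<^sub>C x) = c *\<^sub>C f x" "f (r *\<^sub>R x) = r *\<^sub>R f x"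
proof -
  interpret bounded_linear f using assms by (simp add: bounded_clinear_def)
  show "f (x + y) = f x + f y" "f (x - y) = f x - f y" "f (- x) = - f x" "f 0 = 0"
    "f (r *\<^sub>R x) = r *\<^sub>R f x"
    by (auto simp: add diff neg zero scaleR)
  show "f (c *\<^sub>C x) = c *\<^sub>C f x" using assms by (simp add: bounded_clinear_def)
qed

lemma inner_eq_all: "(\<And>x. inner x y = inner x z) \<Longrightarrow> y = z"
  by (metis inner_diff_right inner_eq_zero_iff right_minus_eq)

lemma adjoint_pair_cinner:
  assumes "bounded_clinear f" "adjoint_pair f g"
  shows "cinner (f x) y = cinner x (g y)"
  using assms(2) bounded_clinearD(5)[OF assms(1), of \<i> x]
  by (metis adjoint_pair_def cinner_inner)

lemma adjoint_pair_commute: "adjoint_pair f g \<Longrightarrow> adjoint_pair g f"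
  by (metis adjoint_pair_def inner_commute)

lemma adjoint_pair_bounded_clinear:
  assumes f: "bounded_clinear f" and fg: "adjoint_pair f g"
  shows "bounded_clinear g"
proof -
  note fg = fg[unfolded adjoint_pair_def, rule_format, symmetric]
  obtain K where K: "\<And>x. norm (f x) \<le> norm x * K" "0 \<le> K"
    using f bounded_linear.nonneg_bounded unfolding bounded_clinear_def by blast
  have add: "g (x + y) = g x + g y" for x y
    by (rule inner_eq_all) (simp add: fg inner_add_right)
  have R: "g (r *\<^sub>R y) = r *\<^sub>R g y" for r y
    by (rule inner_eq_all) (simp add: fg inner_add_right)
  have I: "g (\<i> *\<^sub>C y) = \<i> *\<^sub>C g y" for y
    by (rule inner_eq_all) (simp add: fg inner_i_right bounded_clinearD[OF f])
  show ?thesis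
  proof (rule bounded_clinearI[where K = K])
    show "g (c *\<^sub>C y) = c *\<^sub>C g y" for c y
      by (simp add: scaleC_Complex[of c] add R I)
    show "norm (g y) \<le> K * norm y" for y
    proof -
      have "norm (g y) * norm (g y) = inner (f (g y)) y"
        by (simp add: fg[symmetric] power2_norm_eq_inner[symmetric] power2_eq_square)
      also have "\<dots> \<le> norm (f (g y)) * norm y" by (rule norm_cauchy_schwarz)
      also have "\<dots> \<le> norm (g y) * (K * norm y)"
        using mult_right_mono[OF K(1)[of "g y"], of "norm y"] by (simp add: algebra_simps)
      finally show ?thesis
        using K(2) by (cases "g y = 0") auto
    qed
  qed (rule add)
qed

lemma bounded_adjoint_exists:
  assumes f: "bounded_clinear f"
  obtains g where "bounded_clinear g" "adjoint_pair f g"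
proof -
  have "\<exists>z. \<forall>x. inner (f x) y = inner x z" for y
  proof -
    have "bounded_linear (\<lambda>x. inner (f x) y)"
      using f unfolding bounded_clinear_def
      by (intro bounded_linear_compose[OF bounded_linear_inner_left]) auto
    then obtain z where "\<And>x. inner (f x) y = inner x z"
      using riesz_representation by blast
    then show ?thesis by blast
  qed
  then obtain g where "adjoint_pair f g" unfolding adjoint_pair_def by metis
  then show ?thesis using that adjoint_pair_bounded_clinear[OF f] by blast
qed

subsection \<open>Coercive operators and square roots\<close>

lemma coercive_contraction:
  assumes f: "bounded_clinear f" and m: "0 < m"
    and co: "\<And>x. m * (norm x)\<^sup>2 \<le> inner (f x) x"
  obtains e q :: real where "e > 0" "0 \<le> q" "q < 1" "\<And>x. norm (x - e *\<^sub>R f x) \<le> q * norm x"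
proof -
  obtain K0 where K0: "\<And>x. norm (f x) \<le> norm x * K0"
    using f bounded_linear.bounded unfolding bounded_clinear_def by blast
  \<comment> \<open>Any bound exceeding \<open>m\<close> will do: it keeps
    \<open>1 - m^2 / K^2\<close> positive under the root below.\<close>
  define K where "K = max K0 (m + 1)"
  have K: "norm (f x) \<le> K * norm x" for x
    using K0[of x] mult_left_mono[of K0 K "norm x"] by (simp add: K_def mult.commute)
  have Km: "K > m" "K > 0" using m by (auto simp: K_def)
  \<comment> \<open>The squared norm of \<open>x - e f x\<close> is at most
    \<open>1 - 2 e m + e^2 K^2\<close> times that of \<open>x\<close>; this \<open>e\<close>
    minimizes the factor, and \<open>q\<close> is the root of the minimum.\<close>
  define e where "e = m / K\<^sup>2"
  define q where "q = sqrt (1 - m\<^sup>2 / K\<^sup>2)"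
  have lt: "m\<^sup>2 / K\<^sup>2 \<le> 1" "0 < m\<^sup>2 / K\<^sup>2" using Km m by (simp_all add: power_mono)
  have "norm (x - e *\<^sub>R f x) \<le> q * norm x" for x
  proof (rule power2_le_imp_le)
    have e0: "0 < e" using m Km by (simp add: e_def)
    have "(norm (x - e *\<^sub>R f x))\<^sup>2 = (norm x)\<^sup>2 - 2 * e * inner (f x) x + e\<^sup>2 * (norm (f x))\<^sup>2"
      unfolding power2_norm_eq_inner
      by (simp add: inner_diff inner_commute algebra_simps power2_eq_square)
    also have "\<dots> \<le> (norm x)\<^sup>2 - 2 * e * (m * (norm x)\<^sup>2) + e\<^sup>2 * (K * norm x)\<^sup>2"
    proof -
      have "e * (m * (norm x)\<^sup>2) \<le> e * inner (f x) x"
        using co e0 by (intro mult_left_mono) auto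
      moreover have "e\<^sup>2 * (norm (f x))\<^sup>2 \<le> e\<^sup>2 * (K * norm x)\<^sup>2"
        using K[of x] by (intro mult_left_mono power_mono) auto
      ultimately show ?thesis by linarith
    qed
    also have "\<dots> = (1 - m\<^sup>2 / K\<^sup>2) * (norm x)\<^sup>2"
      using Km by (simp add: e_def field_simps power2_eq_square)
    also have "\<dots> = (q * norm x)\<^sup>2"
      using lt by (simp add: q_def power_mult_distrib)
    finally show "(norm (x - e *\<^sub>R f x))\<^sup>2 \<le> (q * norm x)\<^sup>2" .
    show "0 \<le> q * norm x" using lt by (simp add: q_def)
  qed
  then show ?thesis
    using lt m Km by (intro that[of e q]) (simp_all add: q_def e_def)
qed

text \<open>Lax-Milgram by iteration: solutions of \<open>f x = y\<close> are the fixed points of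
  the contraction sending \<open>x\<close> to \<open>x - e f x + e y\<close>. Coercivity also bounds
  \<open>f\<close> from below, hence the inverse from above.\<close>

lemma coercive_bij:
  fixes f :: "'a::complex_hilbert_space \<Rightarrow> 'a"
  assumes f: "bounded_clinear f" and m: "0 < m"
    and co: "\<And>x. m * (norm x)\<^sup>2 \<le> inner (f x) x"
  shows "bij f" "bounded_clinear (inv f)"
proof -
  obtain e q :: real where eq: "e > 0" "0 \<le> q" "q < 1" "\<And>x. norm (x - e *\<^sub>R f x) \<le> q * norm x"
    using coercive_contraction[OF assms] by blast
  note f' = bounded_clinearD[OF f]
  have lb: "m * norm x \<le> norm (f x)" for x
  proof (cases "x = 0")
    case False
    have "norm x * (m * norm x) \<le> norm x * norm (f x)"
      using co[of x] norm_cauchy_schwarz[of "f x" x] by (simp add: power2_eq_square algebra_simps)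
    then show ?thesis using False by simp
  qed (simp add: f')
  have inj: "inj f"
  proof (rule injI)
    fix x y assume "f x = f y"
    then have "m * norm (x - y) \<le> 0" using lb[of "x - y"] by (simp add: f')
    then show "x = y" using m by (simp add: mult_le_0_iff)
  qed
  have "\<exists>x. f x = y" for y
  proof -
    have "\<exists>!x. x - e *\<^sub>R f x + e *\<^sub>R y = x"
    proof (rule banach_fix_type[OF eq(2,3)], intro allI)
      fix x z
      have "dist (x - e *\<^sub>R f x + e *\<^sub>R y) (z - e *\<^sub>R f z + e *\<^sub>R y)
          = norm ((x - z) - e *\<^sub>R f (x - z))"
        by (simp add: dist_norm f' algebra_simps)
      then show "dist (x - e *\<^sub>R f x + e *\<^sub>R y) (z - e *\<^sub>R f z + e *\<^sub>R y) \<le> q * dist x z"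
        using eq(4)[of "x - z"] by (simp add: dist_norm)
    qed
    then obtain x where "x - e *\<^sub>R f x + e *\<^sub>R y = x" by blast
    then have "e *\<^sub>R (y - f x) = 0" by (simp add: algebra_simps)
    then show ?thesis using eq(1) by auto
  qed
  then have "surj f" by (metis surj_def)
  with inj show b: "bij f" by (simp add: bij_def)
  then have fi: "f (inv f x) = x" for x by (simp add: bij_is_surj surj_f_inv_f)
  show "bounded_clinear (inv f)"
  proof (rule bounded_clinearI[where K = "1/m"])
    show "norm (inv f x) \<le> 1/m * norm x" for x
      using lb[of "inv f x"] m by (simp add: fi field_simps)
    show "inv f (x + y) = inv f x + inv f y" for x y
      by (rule injD[OF inj]) (simp add: fi f')
    show "inv f (c *\<^sub>C x) = c *\<^sub>C inv f x" for c x
      by (rule injD[OF inj]) (simp add: fi f')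
  qed
qed

text \<open>For small \<open>e > 0\<close> the operator \<open>r = 1 - e p\<close> is a strict contraction, and \<open>1 - s\<close> squares to
  \<open>1 - r\<close> iff \<open>s\<close> is a fixed point of \<open>s \<mapsto> (r + s\<^sup>2) / 2\<close>, which is a contraction of the
  self-adjoint operators of norm at most \<open>\<parallel>r\<parallel>\<close> commuting with the commutant of \<open>p\<close>.\<close>

lemma coercive_sqrt:
  fixes p :: "'a::complex_hilbert_space \<Rightarrow> 'a"
  assumes p: "bounded_clinear p" and m: "0 < m"
    and co: "\<And>x. m * (norm x)\<^sup>2 \<le> inner (p x) x" and sa: "adjoint_pair p p"
  obtains s c where "bounded_clinear s" "adjoint_pair s s" "0 < c"
    "\<And>x. c * (norm x)\<^sup>2 \<le> inner (s x) x" "\<And>x. s (s x) = p x"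
    "\<And>b x. bounded_linear b \<Longrightarrow> (\<And>x. b (p x) = p (b x)) \<Longrightarrow> b (s x) = s (b x)"
proof -
  obtain e q :: real where eq: "e > 0" "0 \<le> q" "q < 1" "\<And>x. norm (x - e *\<^sub>R p x) \<le> q * norm x"
    using coercive_contraction[OF p m co] by blast
  note p' = bounded_clinearD[OF p]
  have pbl: "bounded_linear p" using p by (simp add: bounded_clinear_def)
  \<comment> \<open>The type of bounded real-linear maps is complete in the operator norm, as the
    fixed point theorem requires.\<close>
  define r where "r = Blinfun (\<lambda>x. x - e *\<^sub>R p x)"
  have r: "blinfun_apply r x = x - e *\<^sub>R p x" for x
    unfolding r_def
    by (subst bounded_linear_Blinfun_apply)
      (auto intro!: bounded_linear_sub bounded_linear_scaleR_right bounded_linear_compose[OF bounded_linear_scaleR_right] pbl)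
  have nr: "norm r \<le> q" by (rule norm_blinfun_bound) (use eq r in auto)
  define F where "F = (\<lambda>s::'a \<Rightarrow>\<^sub>L 'a. (1/2) *\<^sub>R (r + (s o\<^sub>L s)))"
  \<comment> \<open>The commutation clause is closed under limits. It later serves twice: with
    scalar multiplication for \<open>b\<close> it makes the root complex linear, and with another
    root for \<open>b\<close> it gives uniqueness.\<close>
  define Z where "Z = {s::'a \<Rightarrow>\<^sub>L 'a. norm s \<le> q
     \<and> (\<forall>x y. inner (blinfun_apply s x) y = inner x (blinfun_apply s y))
     \<and> (\<forall>b. bounded_linear b \<longrightarrow> (\<forall>x. b (p x) = p (b x)) \<longrightarrow>
          (\<forall>x. b (blinfun_apply s x) = blinfun_apply s (b x)))}"
  have Zcl: "closed Z"
  proof -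
    have "Z = cball 0 q \<inter> (\<Inter>x. \<Inter>y. {s. inner (blinfun_apply s x) y = inner x (blinfun_apply s y)}) \<inter>
     (\<Inter>b\<in>{b. bounded_linear b \<and> (\<forall>x. b (p x) = p (b x))}. \<Inter>x. {s. b (blinfun_apply s x) = blinfun_apply s (b x)})"
      by (auto simp: Z_def)
    moreover have "closed {s. inner (blinfun_apply s x) y = inner x (blinfun_apply s y)}" for x y :: 'a
      by (intro closed_Collect_eq continuous_intros)
    moreover have "closed {s. b (blinfun_apply s x) = blinfun_apply s (b x)}"
      if "bounded_linear b" for x and b :: "'a \<Rightarrow> 'a"
      by (intro closed_Collect_eq continuous_intros bounded_linear.continuous_on[OF that])
    ultimately show ?thesis
      by (auto intro!: closed_INT closed_Int)
  qed
  have nF: "norm (s o\<^sub>L s') \<le> norm s * norm s'" for s s' :: "'a \<Rightarrow>\<^sub>L 'a"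
    by (rule norm_blinfun_compose)
  have "\<exists>!s\<in>Z. F s = s"
  proof (rule Banach_fix[OF _ _ eq(2,3)])
    show "complete Z" using Zcl by (simp add: complete_eq_closed)
    have "0 \<in> Z" using eq by (auto simp: Z_def linear_0 bounded_linear.linear)
    then show "Z \<noteq> {}" by auto
    show "F ` Z \<subseteq> Z"
    proof safe
      fix s assume s: "s \<in> Z"
      have "norm (F s) \<le> (1/2) * (norm r + norm (s o\<^sub>L s))"
        unfolding F_def using norm_triangle_ineq[of r "s o\<^sub>L s"] by simp
      also have "\<dots> \<le> (1/2) * (q + q * q)"
        using nr nF[of s s] mult_mono[of "norm s" q "norm s" q] s eq by (auto simp: Z_def)
      also have "\<dots> \<le> q" using mult_left_le[of q q] eq by (simp add: field_simps)
      finally have 1: "norm (F s) \<le> q" .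
      have 2: "inner (F s x) y = inner x (F s y)" for x y
        using s sa unfolding Z_def adjoint_pair_def F_def
        by (simp add: blinfun.bilinear_simps r inner_simps)
      have 3: "b (F s x) = F s (b x)" if b: "bounded_linear b" "\<And>x. b (p x) = p (b x)" for b x
      proof -
        interpret b: bounded_linear b by (rule b)
        have "b (s x) = s (b x)" for x using s b by (auto simp: Z_def)
        then show ?thesis
          by (simp add: F_def blinfun.bilinear_simps r b.add b.diff b.scaleR b(2))
      qed
      show "F s \<in> Z" using 1 2 3 by (auto simp: Z_def)
    qed
    fix s s' assume s: "s \<in> Z" "s' \<in> Z"
    \<comment> \<open>A difference of squares without commutativity; the factors \<open>s\<close>
      and \<open>s'\<close> have norm at most \<open>q\<close>, so \<open>q\<close> is a Lipschitz
      constant.\<close>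
    have "F s - F s' = (1/2) *\<^sub>R ((s o\<^sub>L (s - s')) + ((s - s') o\<^sub>L s'))"
      unfolding F_def by (rule blinfun_eqI) (simp add: blinfun.bilinear_simps algebra_simps)
    then have "dist (F s) (F s') = (1/2) * norm ((s o\<^sub>L (s - s')) + ((s - s') o\<^sub>L s'))"
      by (simp add: dist_norm)
    also have "\<dots> \<le> (1/2) * (norm s * norm (s - s') + norm (s - s') * norm s')"
      using norm_triangle_ineq[of "s o\<^sub>L (s - s')" "(s - s') o\<^sub>L s'"] nF[of s "s - s'"] nF[of "s - s'" s']
      by simp
    also have "\<dots> \<le> (1/2) * (q * norm (s - s') + norm (s - s') * q)"
      using s by (intro mult_left_mono[of _ _ "1/2"] add_mono mult_right_mono mult_left_mono)
        (auto simp: Z_def)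
    finally show "dist (F s) (F s') \<le> q * dist s s'" by (simp add: dist_norm)
  qed
  then obtain s where s: "s \<in> Z" "F s = s" by blast
  have nn: "norm s \<le> q" and ssa: "\<And>x y. inner (s x) y = inner x (s y)"
    and sc: "\<And>b x. bounded_linear b \<Longrightarrow> (\<And>x. b (p x) = p (b x)) \<Longrightarrow> b (s x) = s (b x)"
    using s(1) by (auto simp: Z_def)
  have fix1: "2 *\<^sub>R s x = x - e *\<^sub>R p x + s (s x)" for x
  proof -
    have "s x = (1/2) *\<^sub>R (x - e *\<^sub>R p x + s (s x))"
      using arg_cong[OF s(2), of "\<lambda>t. blinfun_apply t x"]
      by (simp add: F_def blinfun.bilinear_simps r)
    then have "2 *\<^sub>R s x = 2 *\<^sub>R ((1/2) *\<^sub>R (x - e *\<^sub>R p x + s (s x)))" by (rule arg_cong)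
    then show ?thesis by simp
  qed
  \<comment> \<open>The fixed point equation reads \<open>(1 - s)^2 = e p\<close>, so
    \<open>1 - s\<close> has to be divided by the root of \<open>e\<close>.\<close>
  define k where "k = 1 / sqrt e"
  have k: "k > 0" "k * k * e = 1" using eq(1) by (simp_all add: k_def)
  define t where "t = (\<lambda>x. k *\<^sub>R (x - s x))"
  have tbl: "bounded_linear t" unfolding t_def
    by (intro bounded_linear_compose[OF bounded_linear_scaleR_right] bounded_linear_sub
        bounded_linear_ident blinfun.bounded_linear_right)
  have tc: "b (t x) = t (b x)" if b: "bounded_linear b" "\<And>x. b (p x) = p (b x)" for b x
  proof -
    interpret b: bounded_linear b by (rule b)
    show ?thesis using sc[OF b] by (simp add: t_def b.scaleR b.diff)
  qed
  show ?thesis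
  proof (rule that[of t "k * (1 - q)"])
    have "t (c *\<^sub>C x) = c *\<^sub>C t x" for c x
    proof (rule tc[symmetric])
      show "bounded_linear (\<lambda>x. c *\<^sub>C x :: 'a)"
        using bounded_clinear_scaleC unfolding bounded_clinear_def by blast
    qed (simp add: p')
    with tbl show "bounded_clinear t" by (auto simp: bounded_clinear_def)
    show "adjoint_pair t t" unfolding adjoint_pair_def t_def using ssa by (simp add: inner_simps)
    show "0 < k * (1 - q)" using k eq by simp
    show "k * (1 - q) * (norm x)\<^sup>2 \<le> inner (t x) x" for x
    proof -
      have "inner (s x) x \<le> norm (s x) * norm x" by (rule norm_cauchy_schwarz)
      also have "\<dots> \<le> (norm s * norm x) * norm x" by (intro mult_right_mono norm_blinfun) auto
      also have "\<dots> \<le> (q * norm x) * norm x" using nn by (intro mult_right_mono) auto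
      finally have "(1 - q) * (norm x)\<^sup>2 \<le> inner x x - inner (s x) x"
        by (simp add: power2_norm_eq_inner[symmetric] power2_eq_square algebra_simps)
      then show ?thesis using k unfolding t_def by (simp add: inner_simps)
    qed
    show "t (t x) = p x" for x
    proof -
      have "t (t x) = (k * k) *\<^sub>R (x - 2 *\<^sub>R s x + s (s x))"
        by (simp add: t_def blinfun.bilinear_simps algebra_simps scaleR_2)
      also have "\<dots> = (k * k) *\<^sub>R (e *\<^sub>R p x)" unfolding fix1 by (simp add: algebra_simps)
      also have "\<dots> = p x" using k by simp
      finally show ?thesis .
    qed
    show "b (t x) = t (b x)" if b: "bounded_linear b" "\<And>x. b (p x) = p (b x)" for b x
      by (rule tc[OF b])
  qed
qed

section \<open>Self-adjoint operators\<close>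

definition clinear_on ::
    "'a::complex_hilbert_space set \<Rightarrow> ('a \<Rightarrow> 'b::complex_hilbert_space) \<Rightarrow> bool"
  where "clinear_on D k \<longleftrightarrow> csubspace D
    \<and> (\<forall>x\<in>D. \<forall>y\<in>D. k (x + y) = k x + k y) \<and> (\<forall>c. \<forall>x\<in>D. k (c *\<^sub>C x) = c *\<^sub>C k x)"

text \<open>The final equivalence says that the graph of the adjoint is the graph of
  \<open>k\<close>: one direction is symmetry, the other is maximality of the domain.\<close>

definition selfadjoint_on :: "'a::complex_hilbert_space set \<Rightarrow> ('a \<Rightarrow> 'a) \<Rightarrow> bool"
  where "selfadjoint_on D k \<longleftrightarrow> clinear_on D k \<and> closure D = UNIV
    \<and> (\<forall>y z. (\<forall>x\<in>D. inner (k x) y = inner x z) \<longleftrightarrow> y \<in> D \<and> k y = z)"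

lemma csubspaceD:
  assumes "csubspace D"
  shows "0 \<in> D" "x \<in> D \<Longrightarrow> y \<in> D \<Longrightarrow> x + y \<in> D" "x \<in> D \<Longrightarrow> y \<in> D \<Longrightarrow> x - y \<in> D"
    "x \<in> D \<Longrightarrow> - x \<in> D" "x \<in> D \<Longrightarrow> c *\<^sub>C x \<in> D" "x \<in> D \<Longrightarrow> r *\<^sub>R x \<in> D"
proof -
  have "subspace D" using assms by (simp add: csubspace_iff)
  then show "0 \<in> D" "x \<in> D \<Longrightarrow> y \<in> D \<Longrightarrow> x + y \<in> D" "x \<in> D \<Longrightarrow> y \<in> D \<Longrightarrow> x - y \<in> D"
    "x \<in> D \<Longrightarrow> - x \<in> D" "x \<in> D \<Longrightarrow> r *\<^sub>R x \<in> D"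
    by (auto simp: subspace_0 subspace_add subspace_diff subspace_neg subspace_scale)
  show "x \<in> D \<Longrightarrow> c *\<^sub>C x \<in> D" using assms by (simp add: csubspace_def)
qed

lemma clinear_onD:
  assumes "clinear_on D k"
  shows "csubspace D" "x \<in> D \<Longrightarrow> y \<in> D \<Longrightarrow> k (x + y) = k x + k y"
    "x \<in> D \<Longrightarrow> y \<in> D \<Longrightarrow> k (x - y) = k x - k y" "x \<in> D \<Longrightarrow> k (- x) = - k x" "k 0 = 0"
    "x \<in> D \<Longrightarrow> k (c *\<^sub>C x) = c *\<^sub>C k x" "x \<in> D \<Longrightarrow> k (r *\<^sub>R x) = r *\<^sub>R k x"
proof -
  show D: "csubspace D" and add: "x \<in> D \<Longrightarrow> y \<in> D \<Longrightarrow> k (x + y) = k x + k y" for x y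
    using assms by (auto simp: clinear_on_def)
  show C: "x \<in> D \<Longrightarrow> k (c *\<^sub>C x) = c *\<^sub>C k x" for x c
    using assms by (auto simp: clinear_on_def)
  show N: "x \<in> D \<Longrightarrow> k (- x) = - k x" for x
    using C[of x "- 1"] by (simp add: scaleC_minus_one)
  show "x \<in> D \<Longrightarrow> y \<in> D \<Longrightarrow> k (x - y) = k x - k y"
    using add[of x "- y"] N[of y] csubspaceD(4)[OF D, of y] by simp
  show "k 0 = 0" using add[of 0 0] csubspaceD(1)[OF D] by simp
  show "x \<in> D \<Longrightarrow> k (r *\<^sub>R x) = r *\<^sub>R k x"
    by (simp add: scaleR_scaleC C)
qed

lemma clinear_on_add:
  "clinear_on D k \<Longrightarrow> clinear_on D l \<Longrightarrow> clinear_on D (\<lambda>x. k x + l x)"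
  by (auto simp: clinear_on_def scaleC_add_right)

lemma clinear_on_subset: "clinear_on E k \<Longrightarrow> csubspace D \<Longrightarrow> D \<subseteq> E \<Longrightarrow> clinear_on D k"
  by (auto simp: clinear_on_def subset_iff)

lemma bounded_clinear_clinear_on: "bounded_clinear f \<Longrightarrow> csubspace D \<Longrightarrow> clinear_on D f"
  by (auto simp: clinear_on_def bounded_clinearD)

text \<open>The domain is closed under multiplication by \<i>, and the real identity at
  \<open>\<i> *\<^sub>C x\<close> is the imaginary part of the complex identity at
  \<open>x\<close>.\<close>

lemma cinner_adjoint_iff:
  assumes k: "clinear_on D k"
  shows "(\<forall>x\<in>D. cinner (k x) y = cinner x z) \<longleftrightarrow> (\<forall>x\<in>D. inner (k x) y = inner x z)"
proof
  assume h: "\<forall>x\<in>D. inner (k x) y = inner x z"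
  show "\<forall>x\<in>D. cinner (k x) y = cinner x z"
  proof
    fix x assume x: "x \<in> D"
    have "\<i> *\<^sub>C x \<in> D" using x csubspaceD(5)[OF clinear_onD(1)[OF k]] by blast
    then show "cinner (k x) y = cinner x z"
      using h x by (auto simp: cinner_inner clinear_onD(6)[OF k, symmetric])
  qed
qed (simp add: inner_Re_cinner)

lemma dense_orth_zero:
  assumes "closure D = UNIV" "\<And>x. x \<in> D \<Longrightarrow> inner x y = inner x z"
  shows "y = z"
proof (rule inner_eq_all)
  fix x
  have "closure D \<subseteq> {x. inner x y = inner x z}"
    by (rule closure_minimal) (use assms in \<open>auto intro!: closed_Collect_eq continuous_intros\<close>)
  then show "inner x y = inner x z" using assms by auto
qed

section \<open>Imaginary shifts and relatively bounded perturbations\<close>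

locale selfadjoint_operator =
  fixes D :: "'h::complex_hilbert_space set" and a :: "'h \<Rightarrow> 'h"
  assumes sa: "selfadjoint_on D a"
begin

lemma lin: "clinear_on D a" and dense: "closure D = UNIV"
  and symm: "x \<in> D \<Longrightarrow> y \<in> D \<Longrightarrow> inner (a x) y = inner x (a y)"
  using sa unfolding selfadjoint_on_def by blast+

lemma maximal:
  assumes "\<And>x. x \<in> D \<Longrightarrow> inner (a x) y = inner x z"
  shows "y \<in> D \<and> a y = z"
  using sa assms unfolding selfadjoint_on_def by blast

lemmas D_closed = csubspaceD[OF clinear_onD(1)[OF lin]]
lemmas a_linear = clinear_onD[OF lin]

text \<open>By symmetry of \<open>a\<close>, the cross term
  \<open>inner (a x) (\<i> *\<^sub>C x)\<close> equals its own negative. The identity lets the shift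
  control \<open>a x\<close> and \<open>r x\<close> separately.\<close>

lemma norm_shift:
  assumes "x \<in> D"
  shows "(norm (a x - r *\<^sub>R \<i> *\<^sub>C x))\<^sup>2 = (norm (a x))\<^sup>2 + r\<^sup>2 * (norm x)\<^sup>2"
proof -
  have "inner (a x) (\<i> *\<^sub>C x) = inner x (\<i> *\<^sub>C a x)"
    using symm[of x "\<i> *\<^sub>C x"] assms by (simp add: D_closed a_linear)
  then have "inner (a x) (\<i> *\<^sub>C x) = 0"
    using inner_i_right[of x "a x"] by (simp add: inner_commute)
  then show ?thesis
    unfolding power2_norm_eq_inner
    by (simp add: inner_diff inner_commute inner_i_i power2_eq_square)
qed

lemma norm_shift_ge:
  assumes "x \<in> D"
  shows "norm (a x) \<le> norm (a x - r *\<^sub>R \<i> *\<^sub>C x)" "\<bar>r\<bar> * norm x \<le> norm (a x - r *\<^sub>R \<i> *\<^sub>C x)"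
  by (rule power2_le_imp_le; simp add: norm_shift[OF assms] power_mult_distrib)+

text \<open>The range is closed because the shift is bounded below and \<open>a\<close> has a closed
  graph. A vector \<open>z\<close> orthogonal to the range satisfies \<open>a z = - r \<i> z\<close>
  by maximality, and the bound for the opposite shift gives \<open>z = 0\<close>.\<close>

lemma shift_surj:
  assumes r: "r \<noteq> 0"
  shows "\<exists>x\<in>D. a x - r *\<^sub>R \<i> *\<^sub>C x = y"
proof -
  define f where "f x = a x - r *\<^sub>R \<i> *\<^sub>C x" for x
  have f_add: "f (x + y) = f x + f y" if "x \<in> D" "y \<in> D" for x y
    using that by (simp add: f_def a_linear scaleC_add_right algebra_simps)
  have f_diff: "f (x - y) = f x - f y" if "x \<in> D" "y \<in> D" for x y
    using that by (simp add: f_def a_linear scaleC_diff_right algebra_simps)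
  have f_R: "f (s *\<^sub>R x) = s *\<^sub>R f x" if "x \<in> D" for x s
    using that bounded_clinearD(6)[OF bounded_clinear_scaleC, of \<i> s x]
    by (simp add: f_def a_linear algebra_simps)
  have "f ` D = UNIV"
  proof (rule closed_subspace_eq_UNIV)
    show "subspace (f ` D)"
      unfolding subspace_def
    proof (intro conjI ballI allI)
      show "0 \<in> f ` D" using D_closed(1) by (auto simp: f_def a_linear intro!: image_eqI[of _ _ 0])
    qed (auto simp: f_add[symmetric] f_R[symmetric] D_closed)
    show "closed (f ` D)"
      unfolding closed_sequential_limits
    proof (intro allI impI, elim conjE)
      fix y l assume "\<forall>n. y n \<in> f ` D" and l: "y \<longlonglongrightarrow> l"
      then have "\<forall>n. \<exists>x. x \<in> D \<and> y n = f x" by auto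
      then obtain x where x: "\<And>n. x n \<in> D" "\<And>n. y n = f (x n)" by metis
      have "Cauchy x"
      proof (rule CauchyI)
        fix e :: real assume e: "e > 0"
        have "Cauchy y" using l by (rule LIMSEQ_imp_Cauchy)
        then obtain M where M: "\<And>m n. m \<ge> M \<Longrightarrow> n \<ge> M \<Longrightarrow> norm (y m - y n) < \<bar>r\<bar> * e"
          using CauchyD[of y "\<bar>r\<bar> * e"] e r by auto
        have "norm (x m - x n) < e" if "m \<ge> M" "n \<ge> M" for m n
        proof -
          have "\<bar>r\<bar> * norm (x m - x n) \<le> norm (y m - y n)"
            using norm_shift_ge(2)[of "x m - x n" r] x D_closed(3)
            by (simp add: f_diff[symmetric]) (simp add: f_def)
          also have "\<dots> < \<bar>r\<bar> * e" by (rule M[OF that])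
          finally show ?thesis using r by simp
        qed
        then show "\<exists>M. \<forall>m\<ge>M. \<forall>n\<ge>M. norm (x m - x n) < e" by blast
      qed
      then obtain p where p: "x \<longlonglongrightarrow> p"
        using Cauchy_convergent convergent_def by blast
      have "(\<lambda>n. r *\<^sub>R \<i> *\<^sub>C x n) \<longlonglongrightarrow> r *\<^sub>R \<i> *\<^sub>C p"
        using bounded_clinear_scaleC unfolding bounded_clinear_def
        by (intro tendsto_scaleR tendsto_const bounded_linear.tendsto[OF _ p]) blast
      then have "(\<lambda>n. y n + r *\<^sub>R \<i> *\<^sub>C x n) \<longlonglongrightarrow> l + r *\<^sub>R \<i> *\<^sub>C p"
        by (rule tendsto_add[OF l])
      then have ax: "(\<lambda>n. a (x n)) \<longlonglongrightarrow> l + r *\<^sub>R \<i> *\<^sub>C p" by (simp add: x f_def)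
      \<comment> \<open>Closedness of the graph: the symmetry relation with each \<open>z\<close> in
        \<open>D\<close> passes to the limit, and maximality applies.\<close>
      have "p \<in> D \<and> a p = l + r *\<^sub>R \<i> *\<^sub>C p"
      proof (rule maximal)
        fix z assume z: "z \<in> D"
        have "(\<lambda>n. inner (a z) (x n)) \<longlonglongrightarrow> inner (a z) p" by (intro tendsto_intros p)
        moreover have "(\<lambda>n. inner z (a (x n))) \<longlonglongrightarrow> inner z (l + r *\<^sub>R \<i> *\<^sub>C p)"
          by (intro tendsto_intros ax)
        ultimately show "inner (a z) p = inner z (l + r *\<^sub>R \<i> *\<^sub>C p)"
          using symm[OF z x(1)] LIMSEQ_unique by auto
      qed
      then show "l \<in> f ` D" by (intro image_eqI[of _ _ p]) (auto simp: f_def)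
    qed
    fix z assume z: "\<And>y. y \<in> f ` D \<Longrightarrow> inner y z = 0"
    have "z \<in> D \<and> a z = - r *\<^sub>R \<i> *\<^sub>C z"
    proof (rule maximal)
      fix x assume x: "x \<in> D"
      have "inner (a x) z = r * inner (\<i> *\<^sub>C x) z"
        using z[of "f x"] x by (simp add: f_def inner_diff)
      then show "inner (a x) z = inner x (- r *\<^sub>R \<i> *\<^sub>C z)"
        by (simp add: inner_i_right)
    qed
    then have "norm (a z - (- r) *\<^sub>R \<i> *\<^sub>C z) = 0" "z \<in> D" by auto
    then show "z = 0" using norm_shift_ge(2)[of z "- r"] r by (auto simp: mult_le_0_iff)
  qed
  then have "y \<in> f ` D" by simp
  then show ?thesis by (auto simp: f_def)
qed

lemma shift_inj:
  assumes "r \<noteq> 0" "x \<in> D" "y \<in> D" "a x - r *\<^sub>R \<i> *\<^sub>C x = a y - r *\<^sub>R \<i> *\<^sub>C y"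
  shows "x = y"
proof -
  have "a (x - y) - r *\<^sub>R \<i> *\<^sub>C (x - y) = 0"
    using assms by (simp add: a_linear scaleC_diff_right algebra_simps)
  then show ?thesis
    using norm_shift_ge(2)[of "x - y" r] assms by (simp add: D_closed mult_le_0_iff)
qed

text \<open>With \<open>(A - i r)\<^sup>-\<^sup>1\<close> denoted by \<open>R\<close>, the perturbation satisfies \<open>\<parallel>K R\<parallel> \<le> 1/2\<close> for large \<open>r\<close>.\<close>

lemma perturbed_shift_ex1:
  assumes k: "clinear_on D k" and c: "0 \<le> c"
    and kb: "\<And>x. x \<in> D \<Longrightarrow> norm (k x) \<le> c * norm x + 1/4 * norm (a x)"
    and r: "\<bar>r\<bar> \<ge> 4 * c + 1"
  shows "\<exists>!x. x \<in> D \<and> a x + k x - r *\<^sub>R \<i> *\<^sub>C x = y"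
proof -
  note k' = clinear_onD[OF k]
  have r0: "r \<noteq> 0" using r c by auto
  \<comment> \<open>Each term of \<open>kb\<close> is at most a quarter of the shifted norm:
    \<open>4 * c\<close> in the condition on \<open>r\<close> handles the first, \<open>1/4\<close>
    the second. The additional 1 keeps \<open>r\<close> nonzero when \<open>c = 0\<close>.\<close>
  have half: "norm (k x) \<le> 1/2 * norm (a x - r *\<^sub>R \<i> *\<^sub>C x)" if x: "x \<in> D" for x
  proof -
    have "4 * c * norm x \<le> \<bar>r\<bar> * norm x" using r by (intro mult_right_mono) auto
    then show ?thesis using kb[OF x] norm_shift_ge[OF x, of r] by linarith
  qed
  obtain R where R: "\<And>z. R z \<in> D" "\<And>z. a (R z) - r *\<^sub>R \<i> *\<^sub>C R z = z"
    using shift_surj[OF r0] by metis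
  \<comment> \<open>Substituting \<open>x = R z\<close> turns the perturbed equation into
    \<open>z + k (R z) = y\<close>.\<close>
  have "\<exists>!z. y - k (R z) = z"
  proof (rule banach_fix_type[of "1/2"], simp, simp, intro allI)
    fix z w
    have "norm (k (R w - R z)) \<le> 1/2 * norm (w - z)"
    proof -
      have "a (R w - R z) - r *\<^sub>R \<i> *\<^sub>C (R w - R z)
          = (a (R w) - r *\<^sub>R \<i> *\<^sub>C R w) - (a (R z) - r *\<^sub>R \<i> *\<^sub>C R z)"
        by (simp add: a_linear R(1) scaleC_diff_right algebra_simps)
      then show ?thesis using half[of "R w - R z"] by (simp add: D_closed R)
    qed
    then show "dist (y - k (R z)) (y - k (R w)) \<le> 1/2 * dist z w"
      by (simp add: dist_norm k' R(1) norm_minus_commute)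
  qed
  then obtain z where z: "y - k (R z) = z" by blast
  show ?thesis
  proof (rule ex1I[of _ "R z"])
    show "R z \<in> D \<and> a (R z) + k (R z) - r *\<^sub>R \<i> *\<^sub>C R z = y"
      using R[of z] z by (simp add: algebra_simps)
    fix x assume x: "x \<in> D \<and> a x + k x - r *\<^sub>R \<i> *\<^sub>C x = y"
    define d where "d = x - R z"
    have d: "d \<in> D" using x R(1) by (simp add: d_def D_closed)
    have "a d - r *\<^sub>R \<i> *\<^sub>C d = - k d"
      using x R(1) R(2)[of z] z by (simp add: d_def a_linear k' scaleC_diff_right algebra_simps)
    then have "norm (a d - r *\<^sub>R \<i> *\<^sub>C d) \<le> 1/2 * norm (a d - r *\<^sub>R \<i> *\<^sub>C d)"
      using half[OF d] by simp
    then have "norm (a d - r *\<^sub>R \<i> *\<^sub>C d) = 0" by simp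
    then have "d = 0" using norm_shift_ge(2)[OF d, of r] r0 by (simp add: mult_le_0_iff)
    then show "x = R z" by (simp add: d_def)
  qed
qed

text \<open>A symmetric operator whose shifts by \<open>\<i> r\<close> and \<open>- \<i> r\<close>
  are both onto is self-adjoint: the first provides a candidate \<open>u\<close> in \<open>D\<close>
  for a vector \<open>y\<close> of the adjoint domain, the second shows
  \<open>y = u\<close>.\<close>

lemma kato_rellich:
  assumes k: "clinear_on D k" and c: "0 \<le> c"
    and kb: "\<And>x. x \<in> D \<Longrightarrow> norm (k x) \<le> c * norm x + 1/4 * norm (a x)"
    and ks: "\<And>x y. x \<in> D \<Longrightarrow> y \<in> D \<Longrightarrow> inner (k x) y = inner x (k y)"
  shows "selfadjoint_on D (\<lambda>x. a x + k x)"
  unfolding selfadjoint_on_def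
proof (intro conjI allI iffI)
  show "clinear_on D (\<lambda>x. a x + k x)" by (rule clinear_on_add[OF lin k])
  show "closure D = UNIV" by (rule dense)
next
  fix y z assume "y \<in> D \<and> a y + k y = z"
  then show "\<forall>x\<in>D. inner (a x + k x) y = inner x z"
    by (auto simp: inner_add symm ks)
next
  fix y z assume h: "\<forall>x\<in>D. inner (a x + k x) y = inner x z"
  define r where "r = 4 * c + 1"
  obtain u where u: "u \<in> D" "a u + k u - r *\<^sub>R \<i> *\<^sub>C u = z - r *\<^sub>R \<i> *\<^sub>C y"
    using perturbed_shift_ex1[OF k c kb, of r "z - r *\<^sub>R \<i> *\<^sub>C y"] c by (auto simp: r_def)
  \<comment> \<open>Moving the shifted operator to the other side gives \<open>y\<close> and
    \<open>u\<close> the same inner product with the image of \<open>x\<close>; solving for the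
    image \<open>y - u\<close> makes its norm vanish.\<close>
  obtain x where x: "x \<in> D" "a x + k x - (- r) *\<^sub>R \<i> *\<^sub>C x = y - u"
    using perturbed_shift_ex1[OF k c kb, of "- r" "y - u"] c by (auto simp: r_def)
  have "inner (a x + k x + r *\<^sub>R \<i> *\<^sub>C x) y = inner x (z - r *\<^sub>R \<i> *\<^sub>C y)"
    using h x(1) by (simp add: inner_add_left inner_diff_right inner_i_right)
  moreover have "inner (a x + k x + r *\<^sub>R \<i> *\<^sub>C x) u = inner x (a u + k u - r *\<^sub>R \<i> *\<^sub>C u)"
    using x(1) u(1) by (simp add: inner_add_left inner_add_right inner_diff_right inner_i_right symm ks)
  ultimately have "inner (y - u) (y - u) = 0"
    using x(2) u(2) by (simp add: inner_diff_right)
  then have "y = u" by simp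
  then show "y \<in> D" "a y + k y = z" using u by auto
qed

end

text \<open>\<open>j\<close> stands for \<open>diag(1, -1)\<close>; it exchanges \<open>1 + y\<close> and \<open>1 - y\<close>, the adjoint of \<open>1 + y\<close>.\<close>

locale skew_riccati = selfadjoint_operator D a
  for D :: "'h::complex_hilbert_space set" and a :: "'h \<Rightarrow> 'h" +
  fixes E :: "'h set" and v y j :: "'h \<Rightarrow> 'h"
  assumes v_lin: "clinear_on E v" and DE: "D \<subseteq> E"
    and v_symm: "\<And>x z. x \<in> E \<Longrightarrow> z \<in> E \<Longrightarrow> inner (v x) z = inner x (v z)"
    and v_bound0: "\<And>e. 0 < e \<Longrightarrow> \<exists>c\<ge>0. \<forall>x\<in>D. norm (v x) \<le> c * norm x + e * norm (a x)"
    and y_bounded: "bounded_clinear y"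
    and y_skew: "\<And>x z. inner (y x) z = - inner x (y z)"
    and j_D: "\<And>x. x \<in> D \<Longrightarrow> j x \<in> D" and j_add: "\<And>x z. j (x + z) = j x + j z"
    and j_j: "\<And>x. j (j x) = x" and j_y: "\<And>x. j (y x) = - y (j x)"
begin

section \<open>The Riccati equation, intertwining relations and equality of domains\<close>

definition riccati :: bool
  where "riccati \<longleftrightarrow> (\<forall>x\<in>D. y x \<in> D \<and> a (y x) - y (a x) - y (v (y x)) + v x = 0)"

abbreviation h where "h x \<equiv> a x + v x"

lemmas y_linear = bounded_clinearD[OF y_bounded]
lemmas v_linear = clinear_onD[OF v_lin]
lemmas E_closed = csubspaceD[OF clinear_onD(1)[OF v_lin]]

lemma v_lin_D: "clinear_on D v"
  by (rule clinear_on_subset[OF v_lin a_linear(1) DE])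

lemma h_selfadjoint: "selfadjoint_on D h"
proof -
  obtain c where "c \<ge> 0" "\<forall>x\<in>D. norm (v x) \<le> c * norm x + 1/4 * norm (a x)"
    using v_bound0[of "1/4"] by auto
  then show ?thesis using kato_rellich[OF v_lin_D, of c] v_symm DE by auto
qed

sublocale h: selfadjoint_operator D h by standard (rule h_selfadjoint)

text \<open>The perturbation lemma asks for smallness but not for symmetry, so it applies to
  \<open>- y v\<close>.\<close>

lemma yv_shift_ex1:
  obtains r where "r \<noteq> 0" "\<And>z. \<exists>!x. x \<in> D \<and> (a x - y (v x)) - r *\<^sub>R \<i> *\<^sub>C x = z"
proof -
  obtain K where K: "0 \<le> K" "\<And>x. norm (y x) \<le> norm x * K"
    using y_bounded bounded_linear.nonneg_bounded unfolding bounded_clinear_def by blast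
  \<comment> \<open>Composition with \<open>y\<close> multiplies the relative bound by at most
    \<open>K\<close>, and \<open>K / (4 * (K + 1))\<close> is below \<open>1/4\<close>; adding 1
    avoids division by zero.\<close>
  obtain c where c: "c \<ge> 0" "\<forall>x\<in>D. norm (v x) \<le> c * norm x + 1 / (4 * (K + 1)) * norm (a x)"
    using v_bound0[of "1 / (4 * (K + 1))"] K by auto
  have lin': "clinear_on D (\<lambda>x. - y (v x))"
    using v_lin_D by (simp add: clinear_on_def y_linear scaleC_minus_right)
  have "norm (- y (v x)) \<le> c * K * norm x + 1/4 * norm (a x)" if x: "x \<in> D" for x
  proof -
    have "norm (y (v x)) \<le> (c * norm x + 1 / (4 * (K + 1)) * norm (a x)) * K"
      using K(2)[of "v x"] mult_right_mono[OF c(2)[rule_format, OF x] K(1)] by linarith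
    also have "\<dots> = c * K * norm x + K / (4 * (K + 1)) * norm (a x)" by (simp add: algebra_simps)
    also have "\<dots> \<le> c * K * norm x + 1/4 * norm (a x)"
      using K(1) by (intro add_left_mono mult_right_mono) (auto simp: field_simps)
    finally show ?thesis by simp
  qed
  then have "\<exists>!x. x \<in> D \<and> a x + - y (v x) - (4 * (c * K) + 1) *\<^sub>R \<i> *\<^sub>C x = z" for z
    using perturbed_shift_ex1[OF lin', of "c * K" "4 * (c * K) + 1"] c K by auto
  moreover have "4 * (c * K) + 1 \<noteq> 0"
    using mult_nonneg_nonneg[OF c(1) K(1)] by linarith
  ultimately show ?thesis by (intro that[of "4 * (c * K) + 1"]) auto
qed

text \<open>Skewness gives \<open>inner (y x) x = 0\<close>, hence both \<open>1 + y\<close> and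
  \<open>1 - y\<close> are coercive with constant 1.\<close>

lemma one_plus_y_bij: "bij (\<lambda>x. x + y x)" "bij (\<lambda>x. x - y x)"
  and one_plus_y_inv: "bounded_clinear (inv (\<lambda>x. x + y x))" "bounded_clinear (inv (\<lambda>x. x - y x))"
proof -
  have y0: "inner (y x) x = 0" for x
    using y_skew[of x x] by (simp add: inner_commute)
  have p: "bounded_clinear (\<lambda>x. x + y x)" and m: "bounded_clinear (\<lambda>x. x - y x)"
    by (intro bounded_clinear_add bounded_clinear_diff bounded_clinear_ident y_bounded)+
  show "bij (\<lambda>x. x + y x)" "bounded_clinear (inv (\<lambda>x. x + y x))"
    using coercive_bij[OF p, of 1] by (auto simp: inner_add y0 power2_norm_eq_inner)
  show "bij (\<lambda>x. x - y x)" "bounded_clinear (inv (\<lambda>x. x - y x))"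
    using coercive_bij[OF m, of 1] by (auto simp: inner_diff y0 power2_norm_eq_inner)
qed

lemma one_plus_y_surj: "\<exists>u. u + y u = z" "\<exists>u. u - y u = z"
  using bij_is_surj[OF one_plus_y_bij(1)] bij_is_surj[OF one_plus_y_bij(2)] by (metis surjD)+

text \<open>The differences \<open>(A + V)(1 + Y) - (1 + Y)(A + V Y)\<close> and
  \<open>(1 - Y)(A + V) - (A - Y V)(1 - Y)\<close> both expand to the left-hand side of the Riccati
  equation. The expansion splits \<open>a (x + y x)\<close> and \<open>a (x - y x)\<close>, hence
  the condition \<open>y x \<in> D\<close>.\<close>

lemma riccati_transfer:
  assumes "x \<in> D" "y x \<in> D"
  shows "a (y x) - y (a x) - y (v (y x)) + v x = 0
      \<longleftrightarrow> h (x + y x) = (a x + v (y x)) + y (a x + v (y x))"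
    and "a (y x) - y (a x) - y (v (y x)) + v x = 0
      \<longleftrightarrow> h x - y (h x) = a (x - y x) - y (v (x - y x))"
  using assms DE by (auto simp: a_linear v_linear y_linear algebra_simps subset_iff)

text \<open>Carries domain statements from \<open>1 - y\<close> to \<open>1 + y\<close>, sparing a
  second resolvent argument that would need a relative bound for \<open>V Y\<close>.\<close>

lemma flip_D: "x + y x \<in> D \<longleftrightarrow> j x - y (j x) \<in> D"
proof -
  have "j (x + y x) = j x - y (j x)" by (simp add: j_add j_y)
  then show ?thesis by (metis j_D j_j)
qed

text \<open>For the hard direction, the image of \<open>x - y x\<close> under the shifted
  \<open>A - Y V\<close> is also reached from some \<open>u - y u\<close> with \<open>u\<close> in
  \<open>D\<close>, by intertwining. Uniqueness and injectivity of \<open>1 - y\<close> then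
  identify \<open>x\<close> with \<open>u\<close>.\<close>

lemma riccati_imp_D_iff:
  assumes "riccati"
  shows "x - y x \<in> D \<longleftrightarrow> x \<in> D" and "x + y x \<in> D \<longleftrightarrow> x \<in> D"
proof -
  have minus: "x - y x \<in> D \<longleftrightarrow> x \<in> D" for x
  proof
    assume "x \<in> D"
    then show "x - y x \<in> D" using assms by (simp add: riccati_def D_closed)
  next
    assume w: "x - y x \<in> D"
    obtain r where r: "r \<noteq> 0" "\<And>z. \<exists>!x. x \<in> D \<and> (a x - y (v x)) - r *\<^sub>R \<i> *\<^sub>C x = z"
      using yv_shift_ex1 by blast
    define w where "w = x - y x"
    define z where "z = (a w - y (v w)) - r *\<^sub>R \<i> *\<^sub>C w"
    \<comment> \<open>Intertwining factors the equation: first undo \<open>1 - y\<close>, then solve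
      with the self-adjoint \<open>h\<close>, whose solution lies in \<open>D\<close>.\<close>
    obtain q where q: "q - y q = z"
      using one_plus_y_surj(2) by blast
    obtain u where u: "u \<in> D" "h u - r *\<^sub>R \<i> *\<^sub>C u = q"
      using h.shift_surj[OF r(1), of q] by blast
    have yu: "y u \<in> D" "a (y u) - y (a u) - y (v (y u)) + v u = 0"
      using assms[unfolded riccati_def, THEN bspec, OF u(1)] by (rule conjunct1, rule conjunct2)
    then have "h u - y (h u) = a (u - y u) - y (v (u - y u))"
      using riccati_transfer(2)[OF u(1) yu(1)] by blast
    then have "(a (u - y u) - y (v (u - y u))) - r *\<^sub>R \<i> *\<^sub>C (u - y u)
        = (h u - y (h u)) - r *\<^sub>R \<i> *\<^sub>C (u - y u)" by (rule arg_cong[OF sym])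
    also have "\<dots> = q - y q"
      unfolding u(2)[symmetric] by (simp add: y_linear scaleC_diff_right algebra_simps)
    finally have "(a (u - y u) - y (v (u - y u))) - r *\<^sub>R \<i> *\<^sub>C (u - y u) = q - y q" .
    moreover have "u - y u \<in> D" by (rule D_closed(3)[OF u(1) yu(1)])
    moreover have "w \<in> D" using w by (simp only: w_def)
    moreover have "(a w - y (v w)) - r *\<^sub>R \<i> *\<^sub>C w = q - y q" unfolding q z_def by (rule refl)
    ultimately have "u - y u = x - y x"
      using r(2)[of "q - y q"] unfolding w_def by blast
    then have "u = x" by (rule injD[OF bij_is_inj[OF one_plus_y_bij(2)]])
    then show "x \<in> D" using u by simp
  qed
  then show "x - y x \<in> D \<longleftrightarrow> x \<in> D" .
  show "x + y x \<in> D \<longleftrightarrow> x \<in> D"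
    unfolding flip_D minus by (metis j_D j_j)
qed

text \<open>Pairing the intertwining relation for \<open>A + V Y\<close> with vectors of \<open>D\<close> gives, by self-adjointness
  of \<open>A + V\<close>, the relation \<open>(A + V) (T\<^sup>*)\<^sup>-\<^sup>1 = (T\<^sup>*)\<^sup>-\<^sup>1 (A - Y V)\<close> on \<open>D\<close>. As \<open>A - Y V - i r\<close> is onto
  and \<open>A + V - i r\<close> is one-to-one, this forces \<open>T\<^sup>* D \<subseteq> D\<close>.\<close>

lemma intertwining_imp_riccati:
  assumes D': "\<And>x. x + y x \<in> D \<Longrightarrow> x \<in> D"
    and tw: "\<And>x. x + y x \<in> D \<Longrightarrow> h (x + y x) = (a x + v (y x)) + y (a x + v (y x))"
  shows riccati
proof -
  have yD: "y x \<in> D" if "x + y x \<in> D" for x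
    using D_closed(3)[OF that D'[OF that]] by simp
  have key: "x \<in> D \<and> h x - y (h x) = a (x - y x) - y (v (x - y x))" if w: "x - y x \<in> D" for x
  proof -
    define w where "w = x - y x"
    have wD: "w \<in> D" using that by (simp add: w_def)
    obtain q where q: "q - y q = a w - y (v w)"
      using one_plus_y_surj(2) by blast
    have "x \<in> D \<and> h x = q"
    proof (rule h.maximal)
      fix z assume z: "z \<in> D"
      obtain u where u: "u + y u = z"
        using one_plus_y_surj(1) by blast
      have uD: "u \<in> D" and yu: "y u \<in> D"
        using D'[of u] yD[of u] z unfolding u by blast+
      have dual: "inner (s + y s) p = inner s (p - y p)" for s p
        by (simp add: inner_add inner_diff y_skew)
      have hz: "h z = (a u + v (y u)) + y (a u + v (y u))"
        using tw[of u] z unfolding u by blast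
      have "inner (h z) x = inner (a u + v (y u)) (x - y x)" unfolding hz by (rule dual)
      also have "\<dots> = inner (a u + v (y u)) w" by (simp add: w_def)
      also have "\<dots> = inner u (a w - y (v w))"
        using uD yu wD DE by (auto simp: inner_add_left inner_diff_right symm v_symm y_skew subset_iff)
      also have "\<dots> = inner z q" using dual[of u q] by (simp only: u q)
      finally show "inner (h z) x = inner z q" .
    qed
    then show ?thesis unfolding w_def[symmetric] q[symmetric] by simp
  qed
  have minus: "x - y x \<in> D" if x: "x \<in> D" for x
  proof -
    obtain r where r: "r \<noteq> 0" "\<And>z. \<exists>!x. x \<in> D \<and> (a x - y (v x)) - r *\<^sub>R \<i> *\<^sub>C x = z"
      using yv_shift_ex1 by blast
    define q where "q = h x - r *\<^sub>R \<i> *\<^sub>C x"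
    obtain w where w: "w \<in> D" "(a w - y (v w)) - r *\<^sub>R \<i> *\<^sub>C w = q - y q"
      using r(2)[of "q - y q"] by blast
    obtain u where u: "u - y u = w"
      using one_plus_y_surj(2) by blast
    have uD: "u \<in> D" and hu: "h u - y (h u) = a w - y (v w)"
      using key[of u] w(1) unfolding u by auto
    define p where "p = h u - r *\<^sub>R \<i> *\<^sub>C u"
    have "p - y p = q - y q"
      unfolding w(2)[symmetric] hu[symmetric] p_def unfolding u[symmetric]
      by (simp add: y_linear scaleC_diff_right algebra_simps)
    then have "p = q" by (rule injD[OF bij_is_inj[OF one_plus_y_bij(2)]])
    then have "u = x" using h.shift_inj[OF r(1) uD x] by (simp only: p_def q_def)
    with u w(1) show ?thesis by simp
  qed
  show ?thesis
    unfolding riccati_def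
  proof (intro ballI)
    fix x assume x: "x \<in> D"
    \<comment> \<open>The inclusion for \<open>1 - y\<close>, used at \<open>j x\<close>, becomes
      the one for \<open>1 + y\<close> at \<open>x\<close>.\<close>
    have "j x - y (j x) \<in> D" using minus[OF j_D[OF x]] .
    then have p: "x + y x \<in> D" by (simp only: flip_D)
    then show "y x \<in> D \<and> a (y x) - y (a x) - y (v (y x)) + v x = 0"
      by (intro conjI yD[OF p] iffD2[OF riccati_transfer(1)[OF x yD[OF p]] tw[OF p]])
  qed
qed

end

section \<open>Operators as partial maps\<close>

text \<open>Normal form for partial maps: values of \<open>k\<close> outside \<open>D\<close> are
  immaterial, and sums, products and blocks reduce to separate computations of domain and
  action.\<close>

definition op_of :: "'a set \<Rightarrow> ('a \<Rightarrow> 'b) \<Rightarrow> ('a, 'b) operator"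
  where "op_of D k = (\<lambda>x. Some (k x)) |` D"

lemma op_of_apply [simp]: "op_of D k x = (if x \<in> D then Some (k x) else None)"
  by (simp add: op_of_def restrict_map_def)

lemma dom_op_of [simp]: "dom (op_of D k) = D"
  by (auto simp: op_of_def)

lemma op_of_dom: "K = op_of (dom K) (\<lambda>x. the (K x))"
  by (auto simp: fun_eq_iff domIff)

lemma op_of_cong: "D = E \<Longrightarrow> (\<And>x. x \<in> E \<Longrightarrow> k x = l x) \<Longrightarrow> op_of D k = op_of E l"
  by (auto simp: fun_eq_iff)

lemma op_of_eq_iff: "op_of D k = op_of E l \<longleftrightarrow> D = E \<and> (\<forall>x\<in>E. k x = l x)"
proof
  assume h: "op_of D k = op_of E l"
  then have "D = E" by (metis dom_op_of)
  moreover have "k x = l x" if "x \<in> E" for x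
    using fun_cong[OF h, of x] that \<open>D = E\<close> by simp
  ultimately show "D = E \<and> (\<forall>x\<in>E. k x = l x)" by simp
qed (auto intro: op_of_cong)

lemma Some_op_of: "Some = op_of UNIV (\<lambda>x. x)"
  by (simp add: fun_eq_iff)

lemma op_zero_op_of: "op_zero = op_of UNIV (\<lambda>_. 0)"
  by (simp add: fun_eq_iff op_zero_def)

lemma op_of_plus: "op_of D k +\<^sub>o op_of E l = op_of (D \<inter> E) (\<lambda>x. k x + l x)"
  by (auto simp: fun_eq_iff op_plus_def restrict_map_def)

lemma op_of_minus: "op_of D k -\<^sub>o op_of E l = op_of (D \<inter> E) (\<lambda>x. k x - l x)"
  by (auto simp: fun_eq_iff op_minus_def restrict_map_def)

lemma op_of_uminus: "-\<^sub>o op_of D k = op_of D (\<lambda>x. - k x)"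
  by (auto simp: fun_eq_iff op_uminus_def)

lemma op_of_comp: "op_of E l \<circ>\<^sub>m op_of D k = op_of {x \<in> D. k x \<in> E} (\<lambda>x. l (k x))"
  by (auto simp: fun_eq_iff map_comp_def)

lemma op_of_block:
  "block (op_of D\<^sub>0 k\<^sub>0) (op_of D\<^sub>1 k\<^sub>1) (op_of D\<^sub>2 k\<^sub>2) (op_of D\<^sub>3 k\<^sub>3)
    = op_of ((D\<^sub>0 \<inter> D\<^sub>2) \<times> (D\<^sub>1 \<inter> D\<^sub>3)) (\<lambda>(f, g). (k\<^sub>0 f + k\<^sub>1 g, k\<^sub>2 f + k\<^sub>3 g))"
  by (auto simp: fun_eq_iff block_def restrict_map_def)

lemma op_of_inv: "bij f \<Longrightarrow> op_inv (op_of UNIV f) = op_of UNIV (inv f)"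
proof -
  assume f: "bij f"
  have "op_of UNIV f x = Some z \<longleftrightarrow> x = inv f z" for x z
    using f by (auto simp: bij_def surj_f_inv_f)
  then show ?thesis
    by (auto simp: fun_eq_iff op_inv_def restrict_map_def simp del: op_of_apply)
      (simp_all)
qed

lemma linear_op_of: "linear_op (op_of D k) \<longleftrightarrow> clinear_on D k"
  unfolding linear_op_def clinear_on_def dom_op_of
  by (rule conj_cong[OF refl]) (auto simp: csubspace_def)

lemma bounded_op_of: "bounded_op (op_of UNIV f) \<longleftrightarrow> bounded_clinear f"
proof
  assume "bounded_op (op_of UNIV f)"
  then show "bounded_clinear f"
    unfolding bounded_op_def linear_op_of clinear_on_def by (auto intro: bounded_clinearI)
next
  assume f: "bounded_clinear f"
  then obtain K where "\<And>x. norm (f x) \<le> norm x * K"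
    using bounded_linear.bounded unfolding bounded_clinear_def by blast
  then show "bounded_op (op_of UNIV f)"
    using bounded_clinear_clinear_on[OF f, of UNIV]
    by (auto simp: bounded_op_def linear_op_of csubspace_def mult.commute)
qed

lemma bounded_opE:
  assumes "bounded_op K"
  obtains f where "bounded_clinear f" "K = op_of UNIV f"
proof -
  have K: "K = op_of UNIV (\<lambda>x. the (K x))"
    using op_of_dom[of K] assms by (simp add: bounded_op_def)
  then have "bounded_clinear (\<lambda>x. the (K x))" using assms bounded_op_of by metis
  then show ?thesis using K that by blast
qed

text \<open>Density supplies the uniqueness built into \<open>adj\<close>, so the definite
  description can be traded for its defining property.\<close>

lemma adj_op_of_iff:
  assumes dense: "closure D = UNIV" and k: "clinear_on D k"
  shows "((op_of D k)\<^sup>\<star>) y = Some z \<longleftrightarrow> (\<forall>x\<in>D. inner (k x) y = inner x z)"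
proof -
  let ?P = "\<lambda>z. \<forall>x\<in>D. inner (k x) y = inner x z"
  have P: "(\<forall>x\<in>dom (op_of D k). cinner (the (op_of D k x)) y = cinner x z)
      \<longleftrightarrow> (\<forall>x\<in>D. inner (k x) y = inner x z)" for y z
    using cinner_adjoint_iff[OF k, of y z] by simp
  have unique: "z = z'" if "?P z" "?P z'" for z z'
    using dense_orth_zero[OF dense, of z z'] that by simp
  have adj: "((op_of D k)\<^sup>\<star>) y = (if \<exists>!z. ?P z then Some (THE z. ?P z) else None)"
    unfolding adj_def restrict_map_def P by simp
  show ?thesis
  proof
    assume "((op_of D k)\<^sup>\<star>) y = Some z"
    then have "\<exists>!z. ?P z" "z = (THE z. ?P z)" unfolding adj by (auto split: if_splits)
    then show "?P z" using theI'[of ?P] by blast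
  next
    assume z: "?P z"
    then have e: "\<exists>!z. ?P z" using unique by blast
    have "(THE z. ?P z) = z" by (rule the_equality[where P = ?P]) (use z unique in blast)+
    with e show "((op_of D k)\<^sup>\<star>) y = Some z" unfolding adj by presburger
  qed
qed

lemma adj_bounded_op:
  assumes "bounded_clinear f" "adjoint_pair f g"
  shows "(op_of UNIV f)\<^sup>\<star> = op_of UNIV g"
proof
  fix y
  have "clinear_on UNIV f" using assms(1) bounded_clinear_clinear_on by (auto simp: csubspace_def)
  then have "((op_of UNIV f)\<^sup>\<star>) y = Some (g y)"
    using assms(2) by (simp add: adj_op_of_iff adjoint_pair_def)
  then show "((op_of UNIV f)\<^sup>\<star>) y = op_of UNIV g y" by simp
qed

lemma self_adjoint_op_of: "self_adjoint (op_of D k) \<longleftrightarrow> selfadjoint_on D k"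
proof -
  have "(op_of D k)\<^sup>\<star> = op_of D k \<longleftrightarrow>
      (\<forall>y z. (\<forall>x\<in>D. inner (k x) y = inner x z) \<longleftrightarrow> y \<in> D \<and> k y = z)"
    if dl: "closure D = UNIV" "clinear_on D k"
  proof -
    have "(op_of D k)\<^sup>\<star> = op_of D k \<longleftrightarrow> (\<forall>y z. ((op_of D k)\<^sup>\<star>) y = Some z \<longleftrightarrow> op_of D k y = Some z)"
      by (metis (no_types, opaque_lifting) ext not_None_eq)
    moreover have "op_of D k y = Some z \<longleftrightarrow> y \<in> D \<and> k y = z" for y z by simp
    ultimately show ?thesis unfolding adj_op_of_iff[OF dl] by presburger
  qed
  then show ?thesis
    unfolding self_adjoint_def selfadjoint_on_def densely_defined_def linear_op_of dom_op_of by blast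
qed

lemma positive_op_of:
  "positive_op (op_of UNIV s) \<longleftrightarrow>
    bounded_clinear s \<and> adjoint_pair s s \<and> (\<forall>x. 0 \<le> inner (s x) x)"
proof (cases "bounded_clinear s")
  case True
  have "(op_of UNIV s)\<^sup>\<star> = op_of UNIV s \<longleftrightarrow> adjoint_pair s s"
  proof
    assume h: "(op_of UNIV s)\<^sup>\<star> = op_of UNIV s"
    have "clinear_on UNIV s" using True bounded_clinear_clinear_on by (auto simp: csubspace_def)
    then have "inner (s x) y = inner x (s y)" for x y
      using adj_op_of_iff[of UNIV s y "s y"] h by simp
    then show "adjoint_pair s s" by (simp add: adjoint_pair_def)
  qed (rule adj_bounded_op[OF True])
  moreover have "cinner x (s x) \<in> \<real>\<^sub>\<ge>\<^sub>0 \<longleftrightarrow> 0 \<le> inner (s x) x" if "adjoint_pair s s" for x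
  proof -
    have "inner (\<i> *\<^sub>C x) (s x) = - inner (s x) (\<i> *\<^sub>C x)"
      using that[unfolded adjoint_pair_def, rule_format, of x "\<i> *\<^sub>C x"]
      by (simp add: bounded_clinearD[OF True] inner_i_right)
    then have "inner (\<i> *\<^sub>C x) (s x) = 0" by (simp add: inner_commute)
    then show ?thesis by (simp add: cinner_inner complex_nonneg_Reals_iff inner_commute)
  qed
  ultimately show ?thesis using True by (auto simp: positive_op_def bounded_op_of)
qed (simp add: positive_op_def bounded_op_of)

text \<open>Uniqueness: a positive root \<open>q\<close> of \<open>p\<close> commutes with \<open>p\<close>, hence with the coercive root \<open>s\<close>,
  and \<open>(s + q) (s - q) = 0\<close> with \<open>s + q\<close> coercive.\<close>

lemma op_sqrt_coercive:
  assumes p: "bounded_clinear p" and sa: "adjoint_pair p p"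
    and co: "\<And>x. (norm x)\<^sup>2 \<le> inner (p x) x"
  obtains s where "op_sqrt (op_of UNIV p) = op_of UNIV s" "bounded_clinear s" "adjoint_pair s s"
    "bij s" "bounded_clinear (inv s)" "\<forall>x. 0 \<le> inner (s x) x" "\<forall>x. s (s x) = p x"
    "\<forall>q. bounded_clinear q \<longrightarrow> adjoint_pair q q \<longrightarrow> (\<forall>x. 0 \<le> inner (q x) x)
      \<longrightarrow> (\<forall>x. q (q x) = p x) \<longrightarrow> q = s"
proof -
  obtain s c where s: "bounded_clinear s" "adjoint_pair s s" "0 < c"
    "\<And>x. c * (norm x)\<^sup>2 \<le> inner (s x) x" "\<And>x. s (s x) = p x"
    "\<And>b x. bounded_linear b \<Longrightarrow> (\<And>x. b (p x) = p (b x)) \<Longrightarrow> b (s x) = s (b x)"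
    using coercive_sqrt[OF p zero_less_one _ sa] co by (auto simp: mult_1)
  have pos: "0 \<le> inner (s x) x" for x
    using s(4)[of x] mult_nonneg_nonneg[OF less_imp_le[OF s(3)] zero_le_power2[of "norm x"]]
    by linarith
  have uniq: "q = s" if q: "bounded_clinear q" "adjoint_pair q q" "\<And>x. 0 \<le> inner (q x) x"
    "\<And>x. q (q x) = p x" for q
  proof
    fix x
    have comm: "q (s x) = s (q x)" for x
      by (rule s(6)) (use q in \<open>auto simp: bounded_clinear_def q(4)[symmetric]\<close>)
    define d where "d = s x - q x"
    have "s d + q d = 0"
      using comm[of x] s(5)[of x] q(4)[of x]
      by (simp add: d_def bounded_clinearD[OF s(1)] bounded_clinearD[OF q(1)])
    then have "inner (s d) d + inner (q d) d = 0" by (metis inner_add_left inner_zero_left)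
    then have "c * (norm d)\<^sup>2 \<le> 0" using s(4)[of d] q(3)[of d] by linarith
    then have "d = 0" using s(3) by (simp add: mult_le_0_iff)
    then show "q x = s x" by (simp add: d_def)
  qed
  have "op_sqrt (op_of UNIV p) = op_of UNIV s"
    unfolding op_sqrt_def
  proof (rule the_equality)
    show "positive_op (op_of UNIV s) \<and> op_of UNIV s \<circ>\<^sub>m op_of UNIV s = op_of UNIV p"
      using s pos by (auto simp: positive_op_of op_of_comp intro: op_of_cong)
    fix S assume S: "positive_op S \<and> S \<circ>\<^sub>m S = op_of UNIV p"
    then obtain q where q: "bounded_clinear q" "S = op_of UNIV q"
      using bounded_opE unfolding positive_op_def by blast
    have "q = s"
      by (rule uniq) (use S in \<open>auto simp: q(2) positive_op_of op_of_comp op_of_eq_iff\<close>)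
    then show "S = op_of UNIV s" by (simp add: q(2))
  qed
  then show thesis
    using s(5) pos uniq by (intro that[OF _ s(1,2) coercive_bij[OF s(1,3,4)]]) blast+
qed

text \<open>Self-adjointness describes the graph by identities
  \<open>inner (h u) (f x) = inner u (f z)\<close>, one for each \<open>u\<close> in
  \<open>D\<close>; each is a closed condition on \<open>(x, z)\<close> because \<open>f\<close> is
  continuous.\<close>

lemma selfadjoint_similar:
  fixes f :: "'a::complex_hilbert_space \<Rightarrow> 'b::complex_hilbert_space"
  assumes sa: "selfadjoint_on D h" and f: "bij f" "bounded_clinear f" "bounded_clinear (inv f)"
    and K: "K = op_of {x. f x \<in> D} (\<lambda>x. inv f (h (f x)))"
  shows "closed_op K" "similar_op K (op_of D h)"
proof -
  interpret selfadjoint_operator D h by standard (rule sa)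
  have fi: "f (inv f x) = x" "inv f (f z) = z" for x z
    using f(1) by (auto simp: bij_def surj_f_inv_f)
  have "csubspace {x. f x \<in> D}"
    by (auto simp: csubspace_def bounded_clinearD[OF f(2)] D_closed)
  then have "linear_op K"
    by (auto simp: K linear_op_of clinear_on_def bounded_clinearD[OF f(2)] bounded_clinearD[OF f(3)] a_linear)
  moreover have "closed (Map.graph K)"
  proof -
    have "Map.graph K = {p. \<forall>u\<in>D. inner (h u) (f (fst p)) = inner u (f (snd p))}"
    proof (intro set_eqI, clarify)
      fix x z
      have "(x, z) \<in> Map.graph K \<longleftrightarrow> f x \<in> D \<and> h (f x) = f z"
        using fi by (auto simp: K Map.graph_def)
      also have "\<dots> \<longleftrightarrow> (\<forall>u\<in>D. inner (h u) (f x) = inner u (f z))"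
        using sa unfolding selfadjoint_on_def by blast
      finally show "(x, z) \<in> Map.graph K \<longleftrightarrow>
          (x, z) \<in> {p. \<forall>u\<in>D. inner (h u) (f (fst p)) = inner u (f (snd p))}" by simp
    qed
    also have "\<dots> = (\<Inter>u\<in>D. {p. inner (h u) (f (fst p)) = inner u (f (snd p))})" by auto
    also have "closed \<dots>"
      using f(2) unfolding bounded_clinear_def
      by (intro closed_INT ballI closed_Collect_eq continuous_on_inner continuous_on_const
          bounded_linear.continuous_on[of f] continuous_on_fst continuous_on_snd continuous_on_id) auto
    finally show ?thesis .
  qed
  ultimately show "closed_op K" by (simp add: closed_op_def)
  have "K = op_inv (op_of UNIV f) \<circ>\<^sub>m op_of D h \<circ>\<^sub>m op_of UNIV f"
    by (simp add: op_of_inv[OF f(1)] op_of_comp K)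
  then show "similar_op K (op_of D h)"
    unfolding similar_op_def boundedly_invertible_def using f
    by (auto simp: bounded_op_of op_of_inv intro!: exI[of _ "op_of UNIV f"])
qed

section \<open>Polar decomposition of an invertible operator\<close>

lemma adjoint_pair_inv:
  assumes "bij s" "adjoint_pair s t" "bij t"
  shows "adjoint_pair (inv s) (inv t)"
  using assms unfolding adjoint_pair_def
  by (metis bij_inv_eq_iff)

text \<open>The unitary factor must be \<open>t\<close> after the inverse of \<open>s\<close>, since
  the absolute value \<open>s\<close> is invertible. Its adjoint is a left inverse by
  \<open>s^2 = t' t\<close>, and a right inverse because \<open>t'\<close> is injective.\<close>

lemma polar_decomposition:
  assumes t: "bij t" "bounded_clinear t" and t': "bij t'" "adjoint_pair t t'"
    and s: "bij s" "bounded_clinear s" "adjoint_pair s s" "bounded_clinear (inv s)"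
    and ss: "\<And>x. s (s x) = t' (t x)" and abs: "op_abs (op_of UNIV t) = op_of UNIV s"
  shows "\<exists>!U. unitary_op U \<and> op_of UNIV t = U \<circ>\<^sub>m op_abs (op_of UNIV t)"
    and "op_of UNIV t = U \<circ>\<^sub>m op_abs (op_of UNIV t) \<Longrightarrow> unitary_op U \<Longrightarrow>
      U = op_of UNIV (\<lambda>x. t (inv s x)) \<and> U\<^sup>\<star> = op_of UNIV (\<lambda>x. inv s (t' x))"
proof -
  define u where "u x = t (inv s x)" for x
  define u' where "u' x = inv s (t' x)" for x
  have si: "s (inv s x) = x" "inv s (s x) = x" for x
    using s(1) by (auto simp: bij_def surj_f_inv_f)
  have u_bdd: "bounded_clinear u"
    unfolding u_def by (rule bounded_clinear_compose[OF t(2) s(4)])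
  have uu': "adjoint_pair u u'"
    using t'(2) adjoint_pair_inv[OF s(1,3,1)] by (simp add: adjoint_pair_def u_def u'_def)
  have adj_u: "(op_of UNIV u)\<^sup>\<star> = op_of UNIV u'" by (rule adj_bounded_op[OF u_bdd uu'])
  have 1: "u' (u x) = x" for x by (simp add: u_def u'_def ss[symmetric] si)
  have 2: "u (u' x) = x" for x
  proof -
    have "t' (u (u' x)) = s (s (inv s (inv s (t' x))))" by (simp add: u_def u'_def ss)
    then have "t' (u (u' x)) = t' x" by (simp add: si)
    then show ?thesis using t'(1) by (simp add: bij_def inj_eq)
  qed
  have U: "unitary_op (op_of UNIV u)"
    unfolding unitary_op_def adj_u
    by (auto simp: bounded_op_of u_bdd op_of_comp Some_op_of 1 2 intro: op_of_cong)
  have T: "op_of UNIV t = op_of UNIV u \<circ>\<^sub>m op_abs (op_of UNIV t)"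
    unfolding abs by (auto simp: op_of_comp u_def si intro: op_of_cong)
  have uniq: "U = op_of UNIV u" if "unitary_op U" "op_of UNIV t = U \<circ>\<^sub>m op_abs (op_of UNIV t)" for U
  proof -
    obtain q where q: "U = op_of UNIV q"
      using \<open>unitary_op U\<close> bounded_opE unfolding unitary_op_def by blast
    have qs: "t x = q (s x)" for x
      using that(2) unfolding abs q by (simp add: op_of_comp op_of_eq_iff)
    have "q x = u x" for x using qs[of "inv s x"] by (simp add: u_def si)
    then show ?thesis by (auto simp: q intro: op_of_cong)
  qed
  show "\<exists>!U. unitary_op U \<and> op_of UNIV t = U \<circ>\<^sub>m op_abs (op_of UNIV t)"
    using U T uniq by blast
  show "U = op_of UNIV (\<lambda>x. t (inv s x)) \<and> U\<^sup>\<star> = op_of UNIV (\<lambda>x. inv s (t' x))"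
    if "op_of UNIV t = U \<circ>\<^sub>m op_abs (op_of UNIV t)" "unitary_op U"
    using uniq[OF that(2,1)] adj_u by (auto simp: u_def u'_def)
qed

section \<open>Graph subspaces and block operators\<close>

lemma reducing_for_op_of:
  "reducing_for G (op_of D h) \<longleftrightarrow>
    (csubspace G \<and> closed G \<and> (\<forall>z\<in>D. z \<in> G \<longrightarrow> h z \<in> G))
    \<and> (csubspace (orth_compl G) \<and> closed (orth_compl G)
      \<and> (\<forall>z\<in>D. z \<in> orth_compl G \<longrightarrow> h z \<in> orth_compl G))
    \<and> D = {p + q | p q. p \<in> D \<inter> G \<and> q \<in> D \<inter> orth_compl G}"
proof -
  have "(\<forall>z\<in>D \<inter> G. the (op_of D h z) \<in> G) \<longleftrightarrow> (\<forall>z\<in>D. z \<in> G \<longrightarrow> h z \<in> G)" for G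
    by auto
  then show ?thesis unfolding reducing_for_def invariant_for_def dom_op_of by simp
qed

text \<open>\<open>E\<^sub>0\<close> and \<open>w'\<close> represent the adjoint of \<open>W\<close>
  through its pairing with \<open>w\<close>; bound 0 appears as one inequality for each positive
  \<open>e\<close>, without an infimum.\<close>

locale block_riccati =
  fixes D\<^sub>0 E\<^sub>0 :: "'a::complex_hilbert_space set" and D\<^sub>1 E\<^sub>1 :: "'b::complex_hilbert_space set"
    and a\<^sub>0 :: "'a \<Rightarrow> 'a" and a\<^sub>1 :: "'b \<Rightarrow> 'b" and w :: "'b \<Rightarrow> 'a" and w' :: "'a \<Rightarrow> 'b"
    and x :: "'a \<Rightarrow> 'b" and x' :: "'b \<Rightarrow> 'a"
  assumes sa: "selfadjoint_on (D\<^sub>0 \<times> D\<^sub>1) (\<lambda>(f, g). (a\<^sub>0 f, a\<^sub>1 g))"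
    and v_lin: "clinear_on (E\<^sub>0 \<times> E\<^sub>1) (\<lambda>(f, g). (w g, w' f))"
    and D\<^sub>0E\<^sub>0: "D\<^sub>0 \<subseteq> E\<^sub>0" and D\<^sub>1E\<^sub>1: "D\<^sub>1 \<subseteq> E\<^sub>1"
    and w_adj: "\<And>f g. f \<in> E\<^sub>0 \<Longrightarrow> g \<in> E\<^sub>1 \<Longrightarrow> inner (w g) f = inner g (w' f)"
    and v_bound0: "\<And>e. 0 < e \<Longrightarrow> \<exists>c\<ge>0. \<forall>z\<in>D\<^sub>0 \<times> D\<^sub>1.
      norm (case z of (f, g) \<Rightarrow> (w g, w' f)) \<le> c * norm z + e * norm (case z of (f, g) \<Rightarrow> (a\<^sub>0 f, a\<^sub>1 g))"
    and x_bounded: "bounded_clinear x" and x_adj: "adjoint_pair x x'"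
begin

abbreviation D where "D \<equiv> D\<^sub>0 \<times> D\<^sub>1"

definition a where "a = (\<lambda>(f, g). (a\<^sub>0 f, a\<^sub>1 g))"
definition v where "v = (\<lambda>(f, g). (w g, w' f))"
definition y where "y = (\<lambda>(f, g). (- x' g, x f))"

lemma block_apply [simp]: "a (f, g) = (a\<^sub>0 f, a\<^sub>1 g)" "v (f, g) = (w g, w' f)" "y (f, g) = (- x' g, x f)"
  by (simp_all add: a_def v_def y_def)

lemma x'_bounded: "bounded_clinear x'"
  by (rule adjoint_pair_bounded_clinear[OF x_bounded x_adj])

lemmas x_linear = bounded_clinearD[OF x_bounded]
lemmas x'_linear = bounded_clinearD[OF x'_bounded]

lemma x_inner: "inner (x f) g = inner f (x' g)"
  using x_adj by (simp add: adjoint_pair_def)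

lemma x'_inner: "inner (x' g) f = inner g (x f)"
  using x_inner[of f g] by (simp add: inner_commute)

lemma y_bdd: "bounded_clinear y"
proof -
  obtain K where K: "\<And>f. norm (x f) \<le> norm f * K" "0 \<le> K"
    using x_bounded bounded_linear.nonneg_bounded unfolding bounded_clinear_def by blast
  obtain K' where K': "\<And>f. norm (x' f) \<le> norm f * K'" "0 \<le> K'"
    using x'_bounded bounded_linear.nonneg_bounded unfolding bounded_clinear_def by blast
  show ?thesis
  proof (rule bounded_clinearI[where K = "K + K'"])
    show "y (z + z') = y z + y z'" for z z'
      by (cases z; cases z') (simp add: x_linear x'_linear)
    show "y (c *\<^sub>C z) = c *\<^sub>C y z" for c z
      by (cases z) (simp add: x_linear x'_linear scaleC_prod_def scaleC_minus_right)
    show "norm (y z) \<le> (K + K') * norm z" for z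
    proof (cases z)
      case (Pair f g)
      have "norm (y z) \<le> norm (x' g) + norm (x f)"
        unfolding Pair using norm_Pair_le[of "- x' g" "x f"] by simp
      also have "\<dots> \<le> norm g * K' + norm f * K" using K(1)[of f] K'(1)[of g] by simp
      also have "\<dots> \<le> norm z * K' + norm z * K"
        using norm_fst_le[of f g] norm_snd_le[of g f] K(2) K'(2)
        unfolding Pair by (intro add_mono mult_right_mono) auto
      finally show ?thesis by (simp add: algebra_simps)
    qed
  qed
qed

sublocale skew_riccati D a "E\<^sub>0 \<times> E\<^sub>1" v y "\<lambda>(f, g). (f, - g)"
proof
  show saD: "selfadjoint_on D a" using sa by (simp add: a_def)
  show "clinear_on (E\<^sub>0 \<times> E\<^sub>1) v" using v_lin by (simp add: v_def)
  show "D \<subseteq> E\<^sub>0 \<times> E\<^sub>1" using D\<^sub>0E\<^sub>0 D\<^sub>1E\<^sub>1 by auto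
  show "inner (v z) z' = inner z (v z')" if z: "z \<in> E\<^sub>0 \<times> E\<^sub>1" "z' \<in> E\<^sub>0 \<times> E\<^sub>1" for z z'
  proof -
    obtain f g f' g' where [simp]: "z = (f, g)" "z' = (f', g')" by fastforce
    have "inner (w g) f' = inner g (w' f')" "inner (w g') f = inner g' (w' f)"
      using w_adj z by auto
    then show ?thesis by (simp add: inner_commute)
  qed
  show "\<exists>c\<ge>0. \<forall>z\<in>D. norm (v z) \<le> c * norm z + e * norm (a z)" if "0 < e" for e
    using v_bound0[OF that] by (simp add: v_def a_def)
  show "bounded_clinear y" by (rule y_bdd)
  show "inner (y z) z' = - inner z (y z')" for z z'
    by (cases z; cases z') (simp add: x_inner x'_inner)
  show "(case z of (f, g) \<Rightarrow> (f, - g)) \<in> D" if z: "z \<in> D" for z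
  proof -
    obtain f g where [simp]: "z = (f, g)" by fastforce
    have D: "csubspace D" using saD by (simp add: selfadjoint_on_def clinear_on_def)
    have "(0, 0) \<in> D" "- z \<in> D" using csubspaceD(1,4)[OF D] z by (auto simp: zero_prod_def)
    then show ?thesis using z by auto
  qed
qed (auto simp: x_linear x'_linear)

lemma zero_mem: "0 \<in> D\<^sub>0" "0 \<in> D\<^sub>1"
  using D_closed(1) by (auto simp: zero_prod_def)

lemma block_zero: "a\<^sub>0 0 = 0" "a\<^sub>1 0 = 0" "w 0 = 0" "w' 0 = 0"
  using a_linear(5) v_linear(5) by (simp_all add: zero_prod_def)

definition t where "t z = z + y z"
definition t' where "t' z = z - y z"

lemma t_apply: "t (f, g) = (f - x' g, x f + g)" and t'_apply: "t' (f, g) = (f + x' g, g - x f)"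
  by (simp_all add: t_def t'_def)

lemma t_bij: "bij t" "bij t'" and t_inv: "bounded_clinear (inv t)" "bounded_clinear (inv t')"
  using one_plus_y_bij one_plus_y_inv by (simp_all add: t_def[abs_def] t'_def[abs_def])

lemma t_bounded: "bounded_clinear t" "bounded_clinear t'"
  unfolding t_def[abs_def] t'_def[abs_def]
  by (intro bounded_clinear_add bounded_clinear_diff bounded_clinear_ident y_bounded)+

lemma t_adj: "adjoint_pair t t'"
  by (simp add: adjoint_pair_def t_def t'_def inner_add inner_diff y_skew)

lemma t_t': "inv t (t z) = z" "t (inv t z) = z" "inv t' (t' z) = z" "t' (inv t' z) = z"
  using t_bij by (simp_all add: bij_def surj_f_inv_f)

section \<open>The graph subspace and its orthogonal complement\<close>

lemma graph_x: "Map.graph (op_of UNIV x) = {z. snd z = x (fst z)}"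
  by (auto simp: Map.graph_def)

text \<open>Pairing \<open>(p, q)\<close> with \<open>(f, x f)\<close> gives
  \<open>cinner f (p + x' q)\<close>, which vanishes for all \<open>f\<close> exactly when
  \<open>p = - x' q\<close>.\<close>

lemma orth_compl_graph_x: "orth_compl {z. snd z = x (fst z)} = {z. fst z = - x' (snd z)}"
proof -
  have "(\<forall>f. cinner f (p + x' q) = 0) \<longleftrightarrow> p = - x' q" for p q
  proof
    assume "\<forall>f. cinner f (p + x' q) = 0"
    then have "inner (p + x' q) (p + x' q) = 0" by (simp only: inner_Re_cinner) simp
    then have "p + x' q = 0" by (simp only: inner_eq_zero_iff)
    then show "p = - x' q" by (simp add: eq_neg_iff_add_eq_0)
  qed (simp add: cinner_inner complex_eq_iff)
  moreover have "cinner (f, x f) (p, q) = cinner f (p + x' q)" for f p q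
    by (simp add: cinner_prod_def cinner_add_right adjoint_pair_cinner[OF x_bounded x_adj])
  moreover have "(p, q) \<in> orth_compl {z. snd z = x (fst z)} \<longleftrightarrow> (\<forall>f. cinner (f, x f) (p, q) = 0)"
    for p q by (auto simp: orth_compl_def)
  ultimately have "(p, q) \<in> orth_compl {z. snd z = x (fst z)} \<longleftrightarrow> (p, q) \<in> {z. fst z = - x' (snd z)}"
    for p q by simp
  then show ?thesis by (simp only: set_eq_iff split_paired_all) simp
qed

lemma graph_closed_subspace:
  "csubspace {z. snd z = x (fst z)}" "closed {z. snd z = x (fst z)}"
  "csubspace {z. fst z = - x' (snd z)}" "closed {z. fst z = - x' (snd z)}"
proof -
  show "csubspace {z. snd z = x (fst z)}" "csubspace {z. fst z = - x' (snd z)}"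
    by (auto simp: csubspace_def x_linear x'_linear scaleC_prod_def scaleC_minus_right)
  have bl: "bounded_linear x" "bounded_linear x'"
    using x_bounded x'_bounded by (simp_all add: bounded_clinear_def)
  show "closed {z. snd z = x (fst z)}"
    by (intro closed_Collect_eq bounded_linear.continuous_on[OF bl(1)]
        continuous_on_fst continuous_on_snd continuous_on_id)
  show "closed {z. fst z = - x' (snd z)}"
    by (intro closed_Collect_eq continuous_on_minus bounded_linear.continuous_on[OF bl(2)]
        continuous_on_fst continuous_on_snd continuous_on_id)
qed

section \<open>Reduction by the graph subspace\<close>

lemma riccatiD:
  assumes R: riccati and u: "u \<in> D"
  shows "y u \<in> D" "a (y u) - y (a u) - y (v (y u)) + v u = 0"
  using R[unfolded riccati_def, THEN bspec, OF u] by (rule conjunct1, rule conjunct2)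

lemma riccati_h_t:
  assumes R: riccati and u: "u \<in> D"
  shows "h (t u) = t (a u + v (y u))"
  using iffD1[OF riccati_transfer(1)[OF u riccatiD(1)[OF R u]] riccatiD(2)[OF R u]]
  by (simp only: t_def)

lemma riccati_t'_h:
  assumes R: riccati and u: "u \<in> D"
  shows "t' (h u) = a (t' u) - y (v (t' u))"
  using iffD1[OF riccati_transfer(2)[OF u riccatiD(1)[OF R u]] riccatiD(2)[OF R u]]
  by (simp only: t'_def)

lemma riccati_t_D:
  assumes R: riccati
  shows "t u \<in> D \<longleftrightarrow> u \<in> D" "t' u \<in> D \<longleftrightarrow> u \<in> D"
  unfolding t_def t'_def by (rule riccati_imp_D_iff[OF R])+

text \<open>\<open>t\<close> maps the two coordinate subspaces onto the graph and its complement.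
  Invariance thus makes \<open>A + V\<close> block diagonal in the coordinates given by
  \<open>t\<close>, while the splitting of the domain places the preimage of \<open>D\<close> under
  \<open>t\<close> inside \<open>D\<close>.\<close>

lemma reducing_iff_riccati:
  "reducing_for (Map.graph (op_of UNIV x)) (op_of D h) \<longleftrightarrow> riccati"
proof
  let ?G = "{z. snd z = x (fst z)}" and ?G' = "{z. fst z = - x' (snd z)}"
  {
    assume "reducing_for (Map.graph (op_of UNIV x)) (op_of D h)"
    then have inv: "\<And>z. z \<in> D \<Longrightarrow> z \<in> ?G \<Longrightarrow> h z \<in> ?G" "\<And>z. z \<in> D \<Longrightarrow> z \<in> ?G' \<Longrightarrow> h z \<in> ?G'"
      and dec: "D = {p + q | p q. p \<in> D \<inter> ?G \<and> q \<in> D \<inter> ?G'}"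
      unfolding reducing_for_op_of graph_x orth_compl_graph_x by blast+
    have dec: "\<exists>p q. z = p + q \<and> p \<in> D \<and> p \<in> ?G \<and> q \<in> D \<and> q \<in> ?G'" if "z \<in> D" for z
      using equalityD1[OF dec, THEN subsetD, OF that] by blast
    \<comment> \<open>Injectivity of \<open>t\<close> makes the decomposition along graph and
      complement unique, so the parts of \<open>t (f, g)\<close> are those provided by the splitting
      of \<open>D\<close>.\<close>
    have split: "f \<in> D\<^sub>0" "x f \<in> D\<^sub>1" "g \<in> D\<^sub>1" "- x' g \<in> D\<^sub>0" if fg: "t (f, g) \<in> D" for f g
    proof -
      obtain p q where pq: "t (f, g) = p + q" "p \<in> D" "p \<in> ?G" "q \<in> D" "q \<in> ?G'"
        using dec[OF fg] by blast
      then have "p = (fst p, x (fst p))" "q = (- x' (snd q), snd q)" by (auto simp: prod_eq_iff)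
      then have "p + q = t (fst p, snd q)" by (auto simp: t_apply prod_eq_iff)
      then have "(f, g) = (fst p, snd q)"
        using pq(1) by (metis bij_is_inj[OF t_bij(1)] injD)
      then show "f \<in> D\<^sub>0" "x f \<in> D\<^sub>1" "g \<in> D\<^sub>1" "- x' g \<in> D\<^sub>0"
        using pq by (auto simp: mem_Times_iff)
    qed
    show riccati
    proof (rule intertwining_imp_riccati)
      fix z assume z: "z + y z \<in> D"
      obtain f g where fg: "z = (f, g)" by fastforce
      note s = split[of f g, OF z[folded t_def, unfolded fg]]
      show "z \<in> D" using s by (simp add: fg)
      define p q where "p = (f, x f)" and "q = (- x' g, g)"
      have pD: "p \<in> D" "q \<in> D" using s by (auto simp: p_def q_def)
      have "h p \<in> ?G" "h q \<in> ?G'"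
        using inv pD by (auto simp: p_def q_def)
      \<comment> \<open>An element of the graph is determined by its first component and one of the
        complement by its second, so a single entry of each image has to be computed.\<close>
      then have hp: "h p = t (a\<^sub>0 f + w (x f), 0)" "h q = t (0, a\<^sub>1 g + w' (- x' g))"
        by (auto simp: p_def q_def t_apply x_linear(4) x'_linear(4))
      have "h (z + y z) = h (p + q)" by (simp add: fg p_def q_def add.commute)
      also have "\<dots> = h p + h q" by (rule h.a_linear(2)[OF pD])
      also have "\<dots> = t (a\<^sub>0 f + w (x f), a\<^sub>1 g + w' (- x' g))"
        unfolding hp by (simp add: t_apply x_linear(4) x'_linear(4))
      finally show "h (z + y z) = (a z + v (y z)) + y (a z + v (y z))"
        by (simp add: fg t_def)
    qed
  }
  assume R: riccati
  note hG = riccati_h_t[OF R] and tD = riccati_t_D(1)[OF R]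
  have G: "z = t (fst z, 0)" if "z \<in> ?G" for z
    using that by (auto simp: t_apply x'_linear(4) prod_eq_iff)
  have G': "z = t (0, snd z)" if "z \<in> ?G'" for z
    using that by (auto simp: t_apply x_linear(4) prod_eq_iff)
  have inv: "h z \<in> ?G" if z: "z \<in> D" "z \<in> ?G" for z
  proof -
    have "(fst z, 0) \<in> D" using z zero_mem by (auto simp: mem_Times_iff)
    then have "h z = t (a (fst z, 0) + v (y (fst z, 0)))"
      using hG[of "(fst z, 0)"] G[OF z(2)] by simp
    then show ?thesis by (simp add: t_apply block_zero x'_linear(4))
  qed
  have inv': "h z \<in> ?G'" if z: "z \<in> D" "z \<in> ?G'" for z
  proof -
    have "(0, snd z) \<in> D" using z zero_mem by (auto simp: mem_Times_iff)
    then have "h z = t (a (0, snd z) + v (y (0, snd z)))"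
      using hG[of "(0, snd z)"] G'[OF z(2)] by simp
    then show ?thesis by (simp add: t_apply block_zero x_linear(4))
  qed
  have dec: "D = {p + q | p q. p \<in> D \<inter> ?G \<and> q \<in> D \<inter> ?G'}"
  proof (rule set_eqI)
    fix z
    show "z \<in> D \<longleftrightarrow> z \<in> {p + q | p q. p \<in> D \<inter> ?G \<and> q \<in> D \<inter> ?G'}"
    proof
      assume z: "z \<in> D"
      obtain f g where fg: "inv t z = (f, g)" by fastforce
      then have zt: "z = t (f, g)" using t_t'(2)[of z] by simp
      then have "(f, g) \<in> D" using z tD by simp
      then have "t (f, 0) \<in> D" "t (0, g) \<in> D"
        unfolding tD using zero_mem by auto
      moreover have "z = t (f, 0) + t (0, g)" unfolding zt
        by (simp add: t_apply x_linear(4) x'_linear(4))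
      ultimately show "z \<in> {p + q | p q. p \<in> D \<inter> ?G \<and> q \<in> D \<inter> ?G'}"
        by (auto simp: t_apply x_linear(4) x'_linear(4))
    next
      assume "z \<in> {p + q | p q. p \<in> D \<inter> ?G \<and> q \<in> D \<inter> ?G'}"
      then obtain p q where "z = p + q" "p \<in> D" "q \<in> D" by blast
      then show "z \<in> D" by (simp only: D_closed(2))
    qed
  qed
  show "reducing_for (Map.graph (op_of UNIV x)) (op_of D h)"
    unfolding reducing_for_op_of graph_x orth_compl_graph_x
    by (intro conjI graph_closed_subspace dec ballI impI inv inv'; assumption)
qed

section \<open>Natural domains, block forms and similarity\<close>

lemma E\<^sub>0_uminus: "- f \<in> E\<^sub>0 \<longleftrightarrow> f \<in> E\<^sub>0" and w'_uminus: "f \<in> E\<^sub>0 \<Longrightarrow> w' (- f) = - w' f"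
proof -
  have "0 \<in> E\<^sub>1" using D\<^sub>1E\<^sub>1 zero_mem by auto
  then show "- f \<in> E\<^sub>0 \<longleftrightarrow> f \<in> E\<^sub>0" "f \<in> E\<^sub>0 \<Longrightarrow> w' (- f) = - w' f"
    using E_closed(4)[of "(f, 0)"] E_closed(4)[of "(- f, 0)"] v_linear(4)[of "(f, 0)"] by auto
qed

text \<open>The corner \<open>- x'\<close> of \<open>y\<close> puts a minus sign inside
  \<open>w'\<close>; drawing it out turns the lower entry into a difference with the same natural
  domain.\<close>

lemma VY_blocks:
  "op_of D a +\<^sub>o (op_of (E\<^sub>0 \<times> E\<^sub>1) v \<circ>\<^sub>m op_of UNIV y)
    = block_diag (op_of D\<^sub>0 a\<^sub>0 +\<^sub>o (op_of E\<^sub>1 w \<circ>\<^sub>m op_of UNIV x))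
        (op_of D\<^sub>1 a\<^sub>1 -\<^sub>o (op_of E\<^sub>0 w' \<circ>\<^sub>m op_of UNIV x'))"
  unfolding op_zero_op_of op_of_comp op_of_plus op_of_minus op_of_block
  by (rule op_of_cong) (auto simp: E\<^sub>0_uminus w'_uminus)

lemma YV_blocks:
  "op_of D a -\<^sub>o (op_of UNIV y \<circ>\<^sub>m op_of (E\<^sub>0 \<times> E\<^sub>1) v)
    = block_diag (op_of D\<^sub>0 a\<^sub>0 +\<^sub>o (op_of UNIV x' \<circ>\<^sub>m op_of E\<^sub>0 w'))
        (op_of D\<^sub>1 a\<^sub>1 -\<^sub>o (op_of UNIV x \<circ>\<^sub>m op_of E\<^sub>1 w))"
  unfolding op_zero_op_of op_of_comp op_of_plus op_of_minus op_of_block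
  using D\<^sub>0E\<^sub>0 D\<^sub>1E\<^sub>1 by (intro op_of_cong) auto

lemma AV_eq: "op_of D a +\<^sub>o op_of (E\<^sub>0 \<times> E\<^sub>1) v = op_of D h"
  unfolding op_of_plus using DE by (intro op_of_cong) auto

lemma AYV_eq: "op_of D a -\<^sub>o (op_of UNIV y \<circ>\<^sub>m op_of (E\<^sub>0 \<times> E\<^sub>1) v) = op_of D (\<lambda>z. a z - y (v z))"
  unfolding op_of_comp op_of_minus using DE by (intro op_of_cong) auto

text \<open>The Riccati equation includes that \<open>y\<close> maps \<open>D\<close> into
  \<open>D\<close>, hence into the domain of \<open>v\<close>, so the product \<open>V Y\<close>
  removes nothing from \<open>D\<close>.\<close>

lemma AVY_eq:
  assumes R: riccati
  shows "op_of D a +\<^sub>o (op_of (E\<^sub>0 \<times> E\<^sub>1) v \<circ>\<^sub>m op_of UNIV y) = op_of D (\<lambda>z. a z + v (y z))"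
proof -
  have "D \<inter> {z \<in> UNIV. y z \<in> E\<^sub>0 \<times> E\<^sub>1} = D"
    using subsetD[OF DE riccatiD(1)[OF R]] by blast
  then show ?thesis unfolding op_of_comp op_of_plus by (intro op_of_cong refl)
qed

lemma similar_AVY:
  assumes R: riccati
  shows "op_of {z. t z \<in> D} (\<lambda>z. inv t (h (t z))) = op_of D (\<lambda>z. a z + v (y z))"
  by (rule op_of_cong) (simp_all add: riccati_t_D[OF R] riccati_h_t[OF R] t_t')

lemma similar_AYV:
  assumes R: riccati
  shows "op_of {z. inv t' z \<in> D} (\<lambda>z. t' (h (inv t' z))) = op_of D (\<lambda>z. a z - y (v z))"
proof (rule op_of_cong)
  have D: "inv t' z \<in> D \<longleftrightarrow> z \<in> D" for z
    using riccati_t_D(2)[OF R, of "inv t' z"] by (simp only: t_t')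
  then show "{z. inv t' z \<in> D} = D" by simp
  show "t' (h (inv t' z)) = a z - y (v z)" if "z \<in> D" for z
    using riccati_t'_h[OF R, of "inv t' z"] that D[of z] by (simp only: t_t')
qed

section \<open>Square roots and the unitary block diagonalization\<close>

lemma sqrt_blocks:
  obtains s\<^sub>0 s\<^sub>1 s where
    "op_sqrt (op_of UNIV (\<lambda>f. f + x' (x f))) = op_of UNIV s\<^sub>0" "bij s\<^sub>0"
    "op_sqrt (op_of UNIV (\<lambda>g. g + x (x' g))) = op_of UNIV s\<^sub>1" "bij s\<^sub>1"
    "op_sqrt (op_of UNIV (\<lambda>z. t' (t z))) = op_of UNIV s" "bij s"
    "bounded_clinear s" "adjoint_pair s s" "bounded_clinear (inv s)" "\<forall>z. s (s z) = t' (t z)"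
    "\<forall>f g. s (f, g) = (s\<^sub>0 f, s\<^sub>1 g)" "\<forall>f g. inv s (f, g) = (inv s\<^sub>0 f, inv s\<^sub>1 g)"
proof -
  have sum: "bounded_clinear (\<lambda>f. f + x' (x f))" "bounded_clinear (\<lambda>g. g + x (x' g))"
    by (rule bounded_clinear_add[OF bounded_clinear_ident bounded_clinear_compose[OF x'_bounded x_bounded]],
        rule bounded_clinear_add[OF bounded_clinear_ident bounded_clinear_compose[OF x_bounded x'_bounded]])
  have adj: "adjoint_pair (\<lambda>f. f + x' (x f)) (\<lambda>f. f + x' (x f))"
    "adjoint_pair (\<lambda>g. g + x (x' g)) (\<lambda>g. g + x (x' g))"
    by (simp_all add: adjoint_pair_def inner_add x_inner x'_inner)
  have ge: "(norm f)\<^sup>2 \<le> inner (f + x' (x f)) f" "(norm g)\<^sup>2 \<le> inner (g + x (x' g)) g" for f g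
    using x'_inner[of "x f" f] x_inner[of "x' g" g]
    by (simp_all add: inner_add_left power2_norm_eq_inner)
  obtain s\<^sub>0 where s\<^sub>0: "op_sqrt (op_of UNIV (\<lambda>f. f + x' (x f))) = op_of UNIV s\<^sub>0"
      "bounded_clinear s\<^sub>0" "adjoint_pair s\<^sub>0 s\<^sub>0" "bij s\<^sub>0" "bounded_clinear (inv s\<^sub>0)"
      "\<forall>f. 0 \<le> inner (s\<^sub>0 f) f" "\<forall>f. s\<^sub>0 (s\<^sub>0 f) = f + x' (x f)"
      "\<forall>q. bounded_clinear q \<longrightarrow> adjoint_pair q q \<longrightarrow> (\<forall>f. 0 \<le> inner (q f) f)
        \<longrightarrow> (\<forall>f. q (q f) = f + x' (x f)) \<longrightarrow> q = s\<^sub>0"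
    by (rule op_sqrt_coercive[OF sum(1) adj(1) ge(1)])
  obtain s\<^sub>1 where s\<^sub>1: "op_sqrt (op_of UNIV (\<lambda>g. g + x (x' g))) = op_of UNIV s\<^sub>1"
      "bounded_clinear s\<^sub>1" "adjoint_pair s\<^sub>1 s\<^sub>1" "bij s\<^sub>1" "bounded_clinear (inv s\<^sub>1)"
      "\<forall>g. 0 \<le> inner (s\<^sub>1 g) g" "\<forall>g. s\<^sub>1 (s\<^sub>1 g) = g + x (x' g)"
      "\<forall>q. bounded_clinear q \<longrightarrow> adjoint_pair q q \<longrightarrow> (\<forall>g. 0 \<le> inner (q g) g)
        \<longrightarrow> (\<forall>g. q (q g) = g + x (x' g)) \<longrightarrow> q = s\<^sub>1"
    by (rule op_sqrt_coercive[OF sum(2) adj(2) ge(2)])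
  have tt: "bounded_clinear (\<lambda>z. t' (t z))" by (rule bounded_clinear_compose[OF t_bounded(2,1)])
  have tt_adj: "adjoint_pair (\<lambda>z. t' (t z)) (\<lambda>z. t' (t z))"
    using t_adj adjoint_pair_commute[OF t_adj] unfolding adjoint_pair_def by metis
  have tt_ge: "(norm z)\<^sup>2 \<le> inner (t' (t z)) z" for z
  proof -
    have "inner (t' (t z)) z = inner (t z) (t z)"
      using adjoint_pair_commute[OF t_adj] unfolding adjoint_pair_def by blast
    also have "\<dots> = inner z z + inner (y z) (y z)"
      using y_skew[of z z] by (simp add: t_def inner_add inner_commute)
    finally show ?thesis by (simp add: power2_norm_eq_inner)
  qed
  obtain s where s: "op_sqrt (op_of UNIV (\<lambda>z. t' (t z))) = op_of UNIV s" "bounded_clinear s"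
      "adjoint_pair s s" "bij s" "bounded_clinear (inv s)"
      "\<forall>z. 0 \<le> inner (s z) z" "\<forall>z. s (s z) = t' (t z)"
      "\<forall>q. bounded_clinear q \<longrightarrow> adjoint_pair q q \<longrightarrow> (\<forall>z. 0 \<le> inner (q z) z)
        \<longrightarrow> (\<forall>z. q (q z) = t' (t z)) \<longrightarrow> q = s"
    by (rule op_sqrt_coercive[OF tt tt_adj tt_ge])
  \<comment> \<open>\<open>t' t\<close> is diagonal with entries \<open>1 + x' x\<close> and
    \<open>1 + x x'\<close>. The diagonal operator of their roots is a positive root of it, so the
    uniqueness clause identifies it with \<open>s\<close>.\<close>
  define q where "q = (\<lambda>(f, g). (s\<^sub>0 f, s\<^sub>1 g))"
  have q: "q (f, g) = (s\<^sub>0 f, s\<^sub>1 g)" for f g by (simp add: q_def)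
  have qp: "q z = (s\<^sub>0 (fst z), s\<^sub>1 (snd z))" for z by (simp add: q_def case_prod_beta)
  have "q = s"
  proof (rule s(8)[rule_format])
    obtain K where K: "\<And>f. norm (s\<^sub>0 f) \<le> norm f * K" "0 \<le> K"
      using s\<^sub>0(2) bounded_linear.nonneg_bounded unfolding bounded_clinear_def by blast
    obtain K' where K': "\<And>f. norm (s\<^sub>1 f) \<le> norm f * K'" "0 \<le> K'"
      using s\<^sub>1(2) bounded_linear.nonneg_bounded unfolding bounded_clinear_def by blast
    show "bounded_clinear q"
    proof (rule bounded_clinearI[where K = "K + K'"])
      show "q (z + z') = q z + q z'" "q (c *\<^sub>C z) = c *\<^sub>C q z" for z z' c
        by (simp_all add: qp scaleC_prod_def bounded_clinearD[OF s\<^sub>0(2)] bounded_clinearD[OF s\<^sub>1(2)])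
      show "norm (q z) \<le> (K + K') * norm z" for z
      proof -
        have "norm (q z) \<le> norm (s\<^sub>0 (fst z)) + norm (s\<^sub>1 (snd z))"
          unfolding qp by (rule norm_Pair_le)
        also have "\<dots> \<le> norm (fst z) * K + norm (snd z) * K'" by (intro add_mono K(1) K'(1))
        also have "\<dots> \<le> norm z * K + norm z * K'"
          using norm_fst_le[of "fst z" "snd z"] norm_snd_le[of "snd z" "fst z"] K(2) K'(2)
          by (intro add_mono mult_right_mono) auto
        finally show ?thesis by (simp add: algebra_simps)
      qed
    qed
    show "adjoint_pair q q"
      using s\<^sub>0(3) s\<^sub>1(3) by (auto simp: adjoint_pair_def q)
    show "0 \<le> inner (q z) z" for z
      using s\<^sub>0(6) s\<^sub>1(6) by (cases z) (simp add: q)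
    show "q (q z) = t' (t z)" for z
      by (cases z) (simp add: q s\<^sub>0(7) s\<^sub>1(7) t_apply t'_apply x_linear x'_linear)
  qed
  then have sq: "s (f, g) = (s\<^sub>0 f, s\<^sub>1 g)" for f g using q by simp
  have "inv s (f, g) = (inv s\<^sub>0 f, inv s\<^sub>1 g)" for f g
  proof (rule inv_f_eq[OF bij_is_inj[OF s(4)]])
    show "s (inv s\<^sub>0 f, inv s\<^sub>1 g) = (f, g)"
      using s\<^sub>0(4) s\<^sub>1(4) by (simp add: sq bij_is_surj surj_f_inv_f)
  qed
  with sq show ?thesis
    by (intro that[OF s\<^sub>0(1,4) s\<^sub>1(1,4) s(1,4,2,3,5,7)]) auto
qed

text \<open>Both conjugations reduce to the intertwining relations through
  \<open>s^2 = t' t\<close>: the inverse of \<open>s\<close> cancels one factor \<open>s\<close>.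
  The block form then only uses that \<open>s\<close> is diagonal.\<close>

lemma unitary_block_diagonalization:
  assumes R: riccati and s: "bij s" "\<And>z. s (s z) = t' (t z)"
    and s\<^sub>0: "bij s\<^sub>0" and s\<^sub>1: "bij s\<^sub>1"
    and split: "\<And>f g. s (f, g) = (s\<^sub>0 f, s\<^sub>1 g)" "\<And>f g. inv s (f, g) = (inv s\<^sub>0 f, inv s\<^sub>1 g)"
    and B\<^sub>0: "B\<^sub>0 = op_of UNIV s\<^sub>0 \<circ>\<^sub>m (op_of D\<^sub>0 a\<^sub>0 +\<^sub>o (op_of E\<^sub>1 w \<circ>\<^sub>m op_of UNIV x)) \<circ>\<^sub>m op_of UNIV (inv s\<^sub>0)"
    and B\<^sub>1: "B\<^sub>1 = op_of UNIV s\<^sub>1 \<circ>\<^sub>m (op_of D\<^sub>1 a\<^sub>1 -\<^sub>o (op_of E\<^sub>0 w' \<circ>\<^sub>m op_of UNIV x')) \<circ>\<^sub>m op_of UNIV (inv s\<^sub>1)"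
    and K: "K = op_of UNIV s \<circ>\<^sub>m op_of D (\<lambda>z. a z + v (y z)) \<circ>\<^sub>m op_of UNIV (inv s)"
  shows "op_of UNIV (\<lambda>z. inv s (t' z)) \<circ>\<^sub>m op_of D h \<circ>\<^sub>m op_of UNIV (\<lambda>z. t (inv s z)) = K"
    and "op_of UNIV (inv s) \<circ>\<^sub>m op_of D (\<lambda>z. a z - y (v z)) \<circ>\<^sub>m op_of UNIV s = K"
    and "block_diag B\<^sub>0 B\<^sub>1 = K" and "dom B\<^sub>0 = s\<^sub>0 ` D\<^sub>0" and "dom B\<^sub>1 = s\<^sub>1 ` D\<^sub>1"
proof -
  have si: "s (inv s z) = z" "inv s (s z) = z" for z
    using s(1) by (simp_all add: bij_def surj_f_inv_f)
  have K: "K = op_of {z. inv s z \<in> D} (\<lambda>z. s (a (inv s z) + v (y (inv s z))))"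
    by (simp add: K op_of_comp)
  have key: "inv s (t' (h (t u))) = s (a u + v (y u))" if u: "u \<in> D" for u
    unfolding riccati_h_t[OF R u] s(2)[symmetric] si ..
  show "op_of UNIV (\<lambda>z. inv s (t' z)) \<circ>\<^sub>m op_of D h \<circ>\<^sub>m op_of UNIV (\<lambda>z. t (inv s z)) = K"
    unfolding K op_of_comp
    by (rule op_of_cong) (simp_all only: riccati_t_D[OF R] key UNIV_I mem_Collect_eq simp_thms)
  \<comment> \<open>It is \<open>s^2 = t' t\<close> that is known to preserve \<open>D\<close>; this
    suffices, as \<open>s z\<close> is \<open>s^2\<close> applied to \<open>inv s z\<close>.\<close>
  have sD: "s z \<in> D \<longleftrightarrow> inv s z \<in> D" and sz: "s z = t' (t (inv s z))" for z
  proof -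
    show sz: "s z = t' (t (inv s z))" unfolding s(2)[symmetric] si ..
    show "s z \<in> D \<longleftrightarrow> inv s z \<in> D" unfolding sz riccati_t_D[OF R] ..
  qed
  have "inv s (a (s z) - y (v (s z))) = s (a (inv s z) + v (y (inv s z)))" if z: "inv s z \<in> D" for z
  proof -
    have "t (inv s z) \<in> D" using z unfolding riccati_t_D[OF R] .
    from riccati_t'_h[OF R this] have "a (s z) - y (v (s z)) = t' (h (t (inv s z)))"
      by (simp only: sz)
    then show ?thesis by (simp only: key[OF z])
  qed
  then show "op_of UNIV (inv s) \<circ>\<^sub>m op_of D (\<lambda>z. a z - y (v z)) \<circ>\<^sub>m op_of UNIV s = K"
    unfolding K op_of_comp
    by (intro op_of_cong) (simp_all only: sD UNIV_I mem_Collect_eq simp_thms)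
  \<comment> \<open>Applying \<open>y\<close> to vectors with one zero entry shows that
    \<open>x\<close> and \<open>x'\<close> respect the component domains, so the diagonal entries
    have domains exactly \<open>D\<^sub>0\<close> and \<open>D\<^sub>1\<close>.\<close>
  have xD: "x f \<in> E\<^sub>1" if "f \<in> D\<^sub>0" for f
    using riccatiD(1)[OF R, of "(f, 0)"] that zero_mem D\<^sub>1E\<^sub>1 by auto
  have x'D: "x' g \<in> E\<^sub>0" if "g \<in> D\<^sub>1" for g
    using riccatiD(1)[OF R, of "(0, g)"] that zero_mem D\<^sub>0E\<^sub>0 E\<^sub>0_uminus[of "x' g"] by auto
  have B\<^sub>0': "B\<^sub>0 = op_of {f. inv s\<^sub>0 f \<in> D\<^sub>0} (\<lambda>f. s\<^sub>0 (a\<^sub>0 (inv s\<^sub>0 f) + w (x (inv s\<^sub>0 f))))"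
    unfolding B\<^sub>0 op_of_comp op_of_plus by (rule op_of_cong) (auto simp: xD)
  have B\<^sub>1': "B\<^sub>1 = op_of {g. inv s\<^sub>1 g \<in> D\<^sub>1} (\<lambda>g. s\<^sub>1 (a\<^sub>1 (inv s\<^sub>1 g) - w' (x' (inv s\<^sub>1 g))))"
    unfolding B\<^sub>1 op_of_comp op_of_minus by (rule op_of_cong) (auto simp: x'D)
  show "block_diag B\<^sub>0 B\<^sub>1 = K"
    unfolding B\<^sub>0' B\<^sub>1' K op_zero_op_of op_of_block
    by (rule op_of_cong) (auto simp: split w'_uminus x'D)
  show "dom B\<^sub>0 = s\<^sub>0 ` D\<^sub>0"
    using bij_image_Collect_eq[OF s\<^sub>0, of "\<lambda>f. f \<in> D\<^sub>0"] by (simp add: B\<^sub>0')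
  show "dom B\<^sub>1 = s\<^sub>1 ` D\<^sub>1"
    using bij_image_Collect_eq[OF s\<^sub>1, of "\<lambda>f. f \<in> D\<^sub>1"] by (simp add: B\<^sub>1')
qed

end

section \<open>The theorem, by passage from partial maps to functions on domains\<close>

theorem theorem4p5:
  fixes A\<^sub>0 :: "('a::complex_hilbert_space, 'a) operator"
    and A\<^sub>1 :: "('b::complex_hilbert_space, 'b) operator"
    and W :: "('b, 'a) operator"
    and X :: "('a, 'b) operator"
    and A V Y T :: "('a \<times> 'b, 'a \<times> 'b) operator"
  assumes A_eq: "A = block_diag A\<^sub>0 A\<^sub>1"
    and A_self_adjoint: "self_adjoint A"
    and W_linear: "linear_op W"
    and W_dense: "densely_defined W"
    and W_dom: "dom A\<^sub>1 \<subseteq> dom W"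
    and W_adj_dom: "dom A\<^sub>0 \<subseteq> dom (W\<^sup>\<star>)"
    and V_eq: "V = block op_zero W (W\<^sup>\<star>) op_zero"
    and X_bounded: "bounded_op X"
    and Y_eq: "Y = block op_zero (-\<^sub>o X\<^sup>\<star>) X op_zero"
    and T_eq: "T = Some +\<^sub>o Y"
    and V_relatively_bounded: "relatively_bounded V A"
    and V_relative_bound: "relative_bound V A = 0"
  shows "(reducing_for (Map.graph X) (A +\<^sub>o V) \<longleftrightarrow> strong_riccati_solution A V Y)
    \<and> (strong_riccati_solution A V Y \<longrightarrow>
        self_adjoint (A +\<^sub>o V)
      \<and> op_inv T \<circ>\<^sub>m (A +\<^sub>o V) \<circ>\<^sub>m T = A +\<^sub>o (V \<circ>\<^sub>m Y)
      \<and> A +\<^sub>o (V \<circ>\<^sub>m Y)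
          = block_diag (A\<^sub>0 +\<^sub>o (W \<circ>\<^sub>m X)) (A\<^sub>1 -\<^sub>o (W\<^sup>\<star> \<circ>\<^sub>m X\<^sup>\<star>))
      \<and> T\<^sup>\<star> \<circ>\<^sub>m (A +\<^sub>o V) \<circ>\<^sub>m op_inv (T\<^sup>\<star>) = A -\<^sub>o (Y \<circ>\<^sub>m V)
      \<and> A -\<^sub>o (Y \<circ>\<^sub>m V)
          = block_diag (A\<^sub>0 +\<^sub>o (X\<^sup>\<star> \<circ>\<^sub>m W\<^sup>\<star>)) (A\<^sub>1 -\<^sub>o (X \<circ>\<^sub>m W))
      \<and> closed_op (A +\<^sub>o (V \<circ>\<^sub>m Y)) \<and> similar_op (A +\<^sub>o (V \<circ>\<^sub>m Y)) (A +\<^sub>o V)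
      \<and> closed_op (A -\<^sub>o (Y \<circ>\<^sub>m V)) \<and> similar_op (A -\<^sub>o (Y \<circ>\<^sub>m V)) (A +\<^sub>o V)
      \<and> (\<exists>!U. unitary_op U \<and> T = U \<circ>\<^sub>m op_abs T)
      \<and> (\<forall>U. unitary_op U \<and> T = U \<circ>\<^sub>m op_abs T \<longrightarrow>
          (let S\<^sub>0 = op_sqrt (Some +\<^sub>o (X\<^sup>\<star> \<circ>\<^sub>m X));
               S\<^sub>1 = op_sqrt (Some +\<^sub>o (X \<circ>\<^sub>m X\<^sup>\<star>));
               B\<^sub>0 = S\<^sub>0 \<circ>\<^sub>m (A\<^sub>0 +\<^sub>o (W \<circ>\<^sub>m X)) \<circ>\<^sub>m op_inv S\<^sub>0;
               B\<^sub>1 = S\<^sub>1 \<circ>\<^sub>m (A\<^sub>1 -\<^sub>o (W\<^sup>\<star> \<circ>\<^sub>m X\<^sup>\<star>)) \<circ>\<^sub>m op_inv S\<^sub>1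
           in U\<^sup>\<star> \<circ>\<^sub>m (A +\<^sub>o V) \<circ>\<^sub>m U
                = op_abs T \<circ>\<^sub>m (A +\<^sub>o (V \<circ>\<^sub>m Y)) \<circ>\<^sub>m op_inv (op_abs T)
            \<and> op_abs T \<circ>\<^sub>m (A +\<^sub>o (V \<circ>\<^sub>m Y)) \<circ>\<^sub>m op_inv (op_abs T)
                = op_inv (op_abs T) \<circ>\<^sub>m (A -\<^sub>o (Y \<circ>\<^sub>m V)) \<circ>\<^sub>m op_abs T
            \<and> op_inv (op_abs T) \<circ>\<^sub>m (A -\<^sub>o (Y \<circ>\<^sub>m V)) \<circ>\<^sub>m op_abs T = block_diag B\<^sub>0 B\<^sub>1
            \<and> dom B\<^sub>0 = (the \<circ> S\<^sub>0) ` dom A\<^sub>0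
            \<and> dom B\<^sub>1 = (the \<circ> S\<^sub>1) ` dom A\<^sub>1)))"
proof -
  obtain D\<^sub>0 a\<^sub>0 where A\<^sub>0: "A\<^sub>0 = op_of D\<^sub>0 a\<^sub>0" using op_of_dom by blast
  obtain D\<^sub>1 a\<^sub>1 where A\<^sub>1: "A\<^sub>1 = op_of D\<^sub>1 a\<^sub>1" using op_of_dom by blast
  obtain E\<^sub>1 w where W: "W = op_of E\<^sub>1 w" using op_of_dom by blast
  obtain E\<^sub>0 w' where W': "W\<^sup>\<star> = op_of E\<^sub>0 w'" using op_of_dom by blast
  obtain x where x: "bounded_clinear x" and X: "X = op_of UNIV x"
    using bounded_opE[OF X_bounded] by blast
  obtain x' where x': "bounded_clinear x'" "adjoint_pair x x'"
    by (rule bounded_adjoint_exists[OF x])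
  have X': "X\<^sup>\<star> = op_of UNIV x'" unfolding X by (rule adj_bounded_op[OF x x'(2)])
  have A: "A = op_of (D\<^sub>0 \<times> D\<^sub>1) (\<lambda>(f, g). (a\<^sub>0 f, a\<^sub>1 g))"
    unfolding A_eq A\<^sub>0 A\<^sub>1 op_zero_op_of op_of_block by (rule op_of_cong) auto
  have V: "V = op_of (E\<^sub>0 \<times> E\<^sub>1) (\<lambda>(f, g). (w g, w' f))"
    unfolding V_eq W' unfolding W op_zero_op_of op_of_block by (rule op_of_cong) auto
  have W_iff: "(W\<^sup>\<star>) f = Some h \<longleftrightarrow> (\<forall>g\<in>E\<^sub>1. inner (w g) f = inner g h)" for f h
    unfolding W
  proof (rule adj_op_of_iff)
    show "closure E\<^sub>1 = UNIV" using W_dense by (simp add: W densely_defined_def)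
    show "clinear_on E\<^sub>1 w" using W_linear by (simp add: W linear_op_of)
  qed
  interpret block_riccati D\<^sub>0 E\<^sub>0 D\<^sub>1 E\<^sub>1 a\<^sub>0 a\<^sub>1 w w' x x'
  proof
    show "selfadjoint_on (D\<^sub>0 \<times> D\<^sub>1) (\<lambda>(f, g). (a\<^sub>0 f, a\<^sub>1 g))"
      using A_self_adjoint unfolding A self_adjoint_op_of .
    show "clinear_on (E\<^sub>0 \<times> E\<^sub>1) (\<lambda>(f, g). (w g, w' f))"
      using V_relatively_bounded unfolding V relatively_bounded_def linear_op_of by blast
    show "D\<^sub>0 \<subseteq> E\<^sub>0" using W_adj_dom unfolding A\<^sub>0 W' dom_op_of .
    show "D\<^sub>1 \<subseteq> E\<^sub>1" using W_dom unfolding A\<^sub>1 W dom_op_of .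
    show "inner (w g) f = inner g (w' f)" if "f \<in> E\<^sub>0" "g \<in> E\<^sub>1" for f g
      using W_iff[of f "w' f"] that by (simp add: W')
    show "\<exists>c\<ge>0. \<forall>z\<in>D\<^sub>0 \<times> D\<^sub>1. norm (case z of (f, g) \<Rightarrow> (w g, w' f))
        \<le> c * norm z + e * norm (case z of (f, g) \<Rightarrow> (a\<^sub>0 f, a\<^sub>1 g))" if e: "0 < e" for e
    proof -
      have sub: "D\<^sub>0 \<times> D\<^sub>1 \<subseteq> E\<^sub>0 \<times> E\<^sub>1"
        using V_relatively_bounded unfolding V A relatively_bounded_def dom_op_of by blast
      obtain c\<^sub>0 b\<^sub>0 where "admissible_bounds V A c\<^sub>0 b\<^sub>0"
        using V_relatively_bounded unfolding relatively_bounded_def by blast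
      then have ne: "{b. \<exists>a. admissible_bounds V A a b} \<noteq> {}" by blast
      \<comment> \<open>The infimum 0 need not be attained, but some admissible \<open>b\<close>
        lies below \<open>e\<close>.\<close>
      have "Inf {b. \<exists>a. admissible_bounds V A a b} < e"
        using V_relative_bound e by (simp add: relative_bound_def)
      from cInf_lessD[OF ne this]
      obtain b c where "b < e" and ad: "admissible_bounds V A c b" by blast
      have "norm (case z of (f, g) \<Rightarrow> (w g, w' f))
          \<le> c * norm z + e * norm (case z of (f, g) \<Rightarrow> (a\<^sub>0 f, a\<^sub>1 g))" if z: "z \<in> D\<^sub>0 \<times> D\<^sub>1" for z
      proof -
        have "norm (case z of (f, g) \<Rightarrow> (w g, w' f))
            \<le> c * norm z + b * norm (case z of (f, g) \<Rightarrow> (a\<^sub>0 f, a\<^sub>1 g))"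
        proof -
          have "z \<in> dom A" using z by (simp only: A dom_op_of)
          then have "norm (the (V z)) \<le> c * norm z + b * norm (the (A z))"
            using ad unfolding admissible_bounds_def by blast
          then show ?thesis
            using z subsetD[OF sub z] by (simp only: A V op_of_apply if_True option.sel)
        qed
        also have "\<dots> \<le> c * norm z + e * norm (case z of (f, g) \<Rightarrow> (a\<^sub>0 f, a\<^sub>1 g))"
          using \<open>b < e\<close> by (intro add_left_mono mult_right_mono) auto
        finally show ?thesis .
      qed
      then show ?thesis using ad unfolding admissible_bounds_def by blast
    qed
    show "bounded_clinear x" "adjoint_pair x x'" by fact+
  qed
  note A = A[folded a_def] and V = V[folded v_def]
  have Y: "Y = op_of UNIV y"
    unfolding Y_eq X' unfolding X op_zero_op_of op_of_uminus op_of_block by (rule op_of_cong) auto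
  have T: "T = op_of UNIV t"
    unfolding T_eq Y Some_op_of op_of_plus by (rule op_of_cong) (simp_all add: t_def)
  have T': "T\<^sup>\<star> = op_of UNIV t'" unfolding T by (rule adj_bounded_op[OF t_bounded(1) t_adj])
  have riccati: "strong_riccati_solution A V Y \<longleftrightarrow> riccati"
    unfolding strong_riccati_solution_def riccati_def A V Y dom_op_of
  proof (rule ball_cong[OF refl], rule conj_cong)
    fix z assume z: "z \<in> D" and yz: "y z \<in> D"
    have "y z \<in> E\<^sub>0 \<times> E\<^sub>1" "z \<in> E\<^sub>0 \<times> E\<^sub>1" by (rule subsetD[OF DE yz], rule subsetD[OF DE z])
    with z yz show "(the ((op_of D a \<circ>\<^sub>m op_of UNIV y) z) - the ((op_of UNIV y \<circ>\<^sub>m op_of D a) z)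
        - the ((op_of UNIV y \<circ>\<^sub>m op_of (E\<^sub>0 \<times> E\<^sub>1) v \<circ>\<^sub>m op_of UNIV y) z)
        + the (op_of (E\<^sub>0 \<times> E\<^sub>1) v z) = 0)
      \<longleftrightarrow> a (y z) - y (a z) - y (v (y z)) + v z = 0"
      by (simp only: op_of_comp op_of_apply mem_Collect_eq UNIV_I simp_thms if_True option.sel)
  qed simp
  have AV: "A +\<^sub>o V = op_of D h" unfolding A V by (rule AV_eq)
  obtain s\<^sub>0 s\<^sub>1 s where S: "op_sqrt (op_of UNIV (\<lambda>f. f + x' (x f))) = op_of UNIV s\<^sub>0" "bij s\<^sub>0"
      "op_sqrt (op_of UNIV (\<lambda>g. g + x (x' g))) = op_of UNIV s\<^sub>1" "bij s\<^sub>1"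
      "op_sqrt (op_of UNIV (\<lambda>z. t' (t z))) = op_of UNIV s" "bij s"
      "bounded_clinear s" "adjoint_pair s s" "bounded_clinear (inv s)"
      "\<forall>z. s (s z) = t' (t z)"
      "\<forall>f g. s (f, g) = (s\<^sub>0 f, s\<^sub>1 g)" "\<forall>f g. inv s (f, g) = (inv s\<^sub>0 f, inv s\<^sub>1 g)"
    by (rule sqrt_blocks)
  have S\<^sub>0: "op_sqrt (Some +\<^sub>o (X\<^sup>\<star> \<circ>\<^sub>m X)) = op_of UNIV s\<^sub>0"
    unfolding X' unfolding X Some_op_of op_of_comp op_of_plus S(1)[symmetric] by simp
  have S\<^sub>1: "op_sqrt (Some +\<^sub>o (X \<circ>\<^sub>m X\<^sup>\<star>)) = op_of UNIV s\<^sub>1"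
    unfolding X' unfolding X Some_op_of op_of_comp op_of_plus S(3)[symmetric] by simp
  have abs: "op_abs T = op_of UNIV s"
    unfolding op_abs_def T' unfolding T op_of_comp S(5)[symmetric] by simp
  note polar = polar_decomposition[OF t_bij(1) t_bounded(1) t_bij(2) t_adj S(6,7,8,9) S(10)[rule_format]
      abs[unfolded T], folded T]
  have reducing: "reducing_for (Map.graph X) (A +\<^sub>o V) \<longleftrightarrow> strong_riccati_solution A V Y"
    unfolding riccati AV X by (rule reducing_iff_riccati)
  have K\<^sub>1: "A +\<^sub>o (V \<circ>\<^sub>m Y) = op_of D (\<lambda>z. a z + v (y z))" if R: riccati
    unfolding A V Y by (rule AVY_eq[OF R])
  have K\<^sub>2: "A -\<^sub>o (Y \<circ>\<^sub>m V) = op_of D (\<lambda>z. a z - y (v z))"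
    unfolding A V Y by (rule AYV_eq)
  have diag: "self_adjoint (A +\<^sub>o V)
      \<and> op_inv T \<circ>\<^sub>m (A +\<^sub>o V) \<circ>\<^sub>m T = A +\<^sub>o (V \<circ>\<^sub>m Y)
      \<and> A +\<^sub>o (V \<circ>\<^sub>m Y) = block_diag (A\<^sub>0 +\<^sub>o (W \<circ>\<^sub>m X)) (A\<^sub>1 -\<^sub>o (W\<^sup>\<star> \<circ>\<^sub>m X\<^sup>\<star>))
      \<and> T\<^sup>\<star> \<circ>\<^sub>m (A +\<^sub>o V) \<circ>\<^sub>m op_inv (T\<^sup>\<star>) = A -\<^sub>o (Y \<circ>\<^sub>m V)
      \<and> A -\<^sub>o (Y \<circ>\<^sub>m V) = block_diag (A\<^sub>0 +\<^sub>o (X\<^sup>\<star> \<circ>\<^sub>m W\<^sup>\<star>)) (A\<^sub>1 -\<^sub>o (X \<circ>\<^sub>m W))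
      \<and> closed_op (A +\<^sub>o (V \<circ>\<^sub>m Y)) \<and> similar_op (A +\<^sub>o (V \<circ>\<^sub>m Y)) (A +\<^sub>o V)
      \<and> closed_op (A -\<^sub>o (Y \<circ>\<^sub>m V)) \<and> similar_op (A -\<^sub>o (Y \<circ>\<^sub>m V)) (A +\<^sub>o V)"
    if R: riccati
  proof (intro conjI)
    show "self_adjoint (A +\<^sub>o V)" unfolding AV self_adjoint_op_of by (rule h_selfadjoint)
    show "op_inv T \<circ>\<^sub>m (A +\<^sub>o V) \<circ>\<^sub>m T = A +\<^sub>o (V \<circ>\<^sub>m Y)"
      unfolding K\<^sub>1[OF R] AV T op_of_inv[OF t_bij(1)] op_of_comp similar_AVY[OF R, symmetric] by simp
    show "A +\<^sub>o (V \<circ>\<^sub>m Y) = block_diag (A\<^sub>0 +\<^sub>o (W \<circ>\<^sub>m X)) (A\<^sub>1 -\<^sub>o (W\<^sup>\<star> \<circ>\<^sub>m X\<^sup>\<star>))"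
      unfolding A V Y A\<^sub>0 A\<^sub>1 W' X' unfolding W X by (rule VY_blocks)
    show "T\<^sup>\<star> \<circ>\<^sub>m (A +\<^sub>o V) \<circ>\<^sub>m op_inv (T\<^sup>\<star>) = A -\<^sub>o (Y \<circ>\<^sub>m V)"
      unfolding K\<^sub>2 AV T' op_of_inv[OF t_bij(2)] op_of_comp similar_AYV[OF R, symmetric] by simp
    show "A -\<^sub>o (Y \<circ>\<^sub>m V) = block_diag (A\<^sub>0 +\<^sub>o (X\<^sup>\<star> \<circ>\<^sub>m W\<^sup>\<star>)) (A\<^sub>1 -\<^sub>o (X \<circ>\<^sub>m W))"
      unfolding A V Y A\<^sub>0 A\<^sub>1 W' X' unfolding W X by (rule YV_blocks)
    show "closed_op (A +\<^sub>o (V \<circ>\<^sub>m Y))" "similar_op (A +\<^sub>o (V \<circ>\<^sub>m Y)) (A +\<^sub>o V)"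
      unfolding K\<^sub>1[OF R] AV similar_AVY[OF R, symmetric]
      by (rule selfadjoint_similar[OF h_selfadjoint t_bij(1) t_bounded(1) t_inv(1) refl])+
    \<comment> \<open>Here the similarity is \<open>inv t'\<close> instead of \<open>t\<close>, so
      the outer factor \<open>t'\<close> has to be written as a double inverse.\<close>
    have K\<^sub>2': "op_of D (\<lambda>z. a z - y (v z))
        = op_of {z. inv t' z \<in> D} (\<lambda>z. inv (inv t') (h (inv t' z)))"
      unfolding similar_AYV[OF R, symmetric] inv_inv_eq[OF t_bij(2)] ..
    have "bounded_clinear (inv (inv t'))" using t_bounded(2) by (simp add: inv_inv_eq[OF t_bij(2)])
    note similar = selfadjoint_similar[OF h_selfadjoint bij_imp_bij_inv[OF t_bij(2)] t_inv(2) this K\<^sub>2']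
    show "closed_op (A -\<^sub>o (Y \<circ>\<^sub>m V))" "similar_op (A -\<^sub>o (Y \<circ>\<^sub>m V)) (A +\<^sub>o V)"
      unfolding K\<^sub>2 AV by (rule similar)+
  qed
  have unitary: "let S\<^sub>0 = op_sqrt (Some +\<^sub>o (X\<^sup>\<star> \<circ>\<^sub>m X));
         S\<^sub>1 = op_sqrt (Some +\<^sub>o (X \<circ>\<^sub>m X\<^sup>\<star>));
         B\<^sub>0 = S\<^sub>0 \<circ>\<^sub>m (A\<^sub>0 +\<^sub>o (W \<circ>\<^sub>m X)) \<circ>\<^sub>m op_inv S\<^sub>0;
         B\<^sub>1 = S\<^sub>1 \<circ>\<^sub>m (A\<^sub>1 -\<^sub>o (W\<^sup>\<star> \<circ>\<^sub>m X\<^sup>\<star>)) \<circ>\<^sub>m op_inv S\<^sub>1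
     in U\<^sup>\<star> \<circ>\<^sub>m (A +\<^sub>o V) \<circ>\<^sub>m U = op_abs T \<circ>\<^sub>m (A +\<^sub>o (V \<circ>\<^sub>m Y)) \<circ>\<^sub>m op_inv (op_abs T)
      \<and> op_abs T \<circ>\<^sub>m (A +\<^sub>o (V \<circ>\<^sub>m Y)) \<circ>\<^sub>m op_inv (op_abs T)
          = op_inv (op_abs T) \<circ>\<^sub>m (A -\<^sub>o (Y \<circ>\<^sub>m V)) \<circ>\<^sub>m op_abs T
      \<and> op_inv (op_abs T) \<circ>\<^sub>m (A -\<^sub>o (Y \<circ>\<^sub>m V)) \<circ>\<^sub>m op_abs T = block_diag B\<^sub>0 B\<^sub>1
      \<and> dom B\<^sub>0 = (the \<circ> S\<^sub>0) ` dom A\<^sub>0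
      \<and> dom B\<^sub>1 = (the \<circ> S\<^sub>1) ` dom A\<^sub>1"
    if R: riccati and U: "unitary_op U" "T = U \<circ>\<^sub>m op_abs T" for U
  proof -
    have Ueq: "U = op_of UNIV (\<lambda>z. t (inv s z))" and U': "U\<^sup>\<star> = op_of UNIV (\<lambda>z. inv s (t' z))"
      using polar(2)[OF U(2,1)] by blast+
    note final = unitary_block_diagonalization[OF R S(6) S(10)[rule_format] S(2,4)
      S(11)[rule_format] S(12)[rule_format] refl refl refl]
    have the_S: "the \<circ> op_of UNIV q = q" for q by (simp add: fun_eq_iff)
    show ?thesis
      unfolding Let_def S\<^sub>0 S\<^sub>1 abs K\<^sub>1[OF R] K\<^sub>2 AV U' op_of_inv[OF S(2)] op_of_inv[OF S(4)] op_of_inv[OF S(6)]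
        the_S
      unfolding Ueq A\<^sub>0 A\<^sub>1 W' X' unfolding W X dom_op_of[of D\<^sub>0] dom_op_of[of D\<^sub>1]
      by (intro conjI final(1) final(4,5) trans[OF final(3) final(2)[symmetric], symmetric] final(2)[symmetric])
  qed
  show ?thesis
  proof (rule conjI[OF reducing], rule impI, goal_cases)
    case 1
    then have R: riccati by (simp only: riccati)
    from diag[OF R] show ?case
      by - (elim conjE, intro conjI allI impI polar(1);
          (assumption | (elim conjE, rule unitary[OF R], assumption+)))
  qed
qed

end
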